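(* Let $\mathcal{S}(\tau)$ and $\mathcal{P}(\tau)$ denote the collections of all $\tau$-properties of finite S-rank and of finite P-rank, respectively, and let $\mathcal{S}=\bigcup_\tau\mathcal{S}(\tau)$ and $\mathcal{P}=\bigcup_\tau\mathcal{P}(\tau)$. Then $\mathcal{S}$ and $\mathcal{P}$ are abstract Lindström logics which have finite S-rank and finite P-rank, respectively.
   Context: Vocabularies $\tau,\sigma$ are finite and relational, possibly with constant symbols. All structures are finite; $\mathrm{Str}(\tau)$ is the class of finite $\tau$-structures. A $\tau$-property is a class of finite $\tau$-structures closed under isomorphism. Translation schemes: for $\tau=\langle R_1,\dots,R_m\rangle$ with $R_i$ of arity $r(i)$, a quantifier-free $k$-vectorized $(\sigma-\tau)$ translation scheme is a sequence $(\phi;\phi_1,\dots,\phi_m)$ of quantifier-free $\sigma$-formulas where $\phi$ has $k$ free variables and $\phi_i$ has $k\cdot r(i)$ free variables; it is scalar if $k=1$. The induced transduction maps a $\sigma$-structure $\mathfrak{A}$ to the $\tau$-structure with universe $\{\bar a\in A^k:\mathfrak{A}\models\phi(\bar a)\}$ in which $R_i$ is the set of $r(i)$-tuples of elements of this universe satisfying $\phi_i$ in $\mathfrak{A}$. Equality is not redefined and constants are not renamed. The disjoint union $\sqcup$ takes disjoint unions of universes and relations; if $\sigma$ has constants $a_1,\dots,a_l$, then the disjoint union has constants $a_1,\dots,a_l$ (from the first structure) and $a_1',\dots,a_l'$ (from the second). An operation $\Box:\mathrm{Str}(\sigma)\times\mathrm{Str}(\sigma)\to\mathrm{Str}(\tau)$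 is sum-like (product-like) if it is obtained from the disjoint union of $\sigma$-structures by applying a quantifier-free scalar (vectorized) transduction to $\tau$-structures. The Hankel matrix $H(\Phi,\Box)$ of a $\tau$-property $\Phi$ is the infinite $(0,1)$-matrix with rows and columns labeled by all finite $\sigma$-structures and $H(\Phi,\Box)_{\mathfrak{A},\mathfrak{B}}=1$ iff $\mathfrak{A}\Box\mathfrak{B}\in\Phi$; its Boolean rank is its rank over $\mathbb{Z}_2$. A $\tau$-property $\Phi$ has finite S-rank (P-rank) if for every $\sigma$ and every sum-like (product-like) operation $\Box:\mathrm{Str}(\sigma)\times\mathrm{Str}(\sigma)\to\mathrm{Str}(\tau)$ the Boolean rank of $H(\Phi,\Box)$ is finite. A logic has finite S-rank (P-rank) if all its definable properties have finite S-rank (P-rank). An abstract Lindström logic (in the sense of Lindström 1969, on finite structures) is a syntax-free logic: a family $\mathrm{Mod}(\tau)$ of $\tau$-properties, one for each vocabulary $\tau$, thought of as the definable $\tau$-properties, which is closed under the logical operations of first order logic with generalized quantifiers. Equivalently, it has a canonical syntax using generalized quantifiers: the properties in $\mathrm{Mod}(\tau)$ are exactly the $\tau$-properties definable by sentences of the extension of first order logic by the Lindström quantifiers $Q_\Phi$ for all $\Phi\in\bigcup_{\tau'}\mathrm{Mod}(\tau')$. Here, for a $\tau'$-property $\Phi$ with $\tau'=\langle R_1,\dots,R_m\rangle$, the formula $Q_\Phi\,\bar x_1\cdots\bar x_m(\theta_1,\dots,\theta_m)$ holds in $\mathfrak{A}$ (under a given assignment to the remaining free variables) iff the $\tau'$-structure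 on the universe of $\mathfrak{A}$ in which each $R_i$ is interpreted as $\{\bar a:\mathfrak{A}\models\theta_i(\bar a)\}$ belongs to $\Phi$. *)

theory Defs
  imports Main "HOL-Library.Function_Algebras" "HOL-Library.Z2" "HOL-Library.Extended_Nat"
begin

section \<open>Finite structures\<close>

text \<open>A vocabulary \<open>Voc [r\<^sub>0, \<dots>, r\<^sub>m\<^sub>-\<^sub>1] l\<close> has relation symbols numbered \<open>0, \<dots>, m - 1\<close> of arity
  \<open>r\<^sub>0, \<dots>, r\<^sub>m\<^sub>-\<^sub>1\<close> and constant symbols numbered \<open>0, \<dots>, l - 1\<close>.\<close>

datatype voc = Voc (ars: "nat list") (ncsts: nat)

datatype 'a struct = Struct (univ: "'a set") (rels: "'a list set list") (csts: "'a list")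

definition tuples :: "'a set \<Rightarrow> nat \<Rightarrow> 'a list set" where
  "tuples U r = {as. length as = r \<and> set as \<subseteq> U}"

text \<open>The empty universe is admitted: a transduction may define it.\<close>

definition Str :: "voc \<Rightarrow> 'a struct set" where
  "Str \<tau> = {A. finite (univ A)
     \<and> length (rels A) = length (ars \<tau>)
     \<and> (\<forall>i<length (ars \<tau>). rels A ! i \<subseteq> tuples (univ A) (ars \<tau> ! i))
     \<and> length (csts A) = ncsts \<tau>
     \<and> set (csts A) \<subseteq> univ A}"

definition isomorphic :: "'a struct \<Rightarrow> 'b struct \<Rightarrow> bool" where
  "isomorphic A B \<longleftrightarrow> (\<exists>h. bij_betw h (univ A) (univ B)
     \<and> rels B = map ((`) (map h)) (rels A)
     \<and> csts B = map h (csts A))"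

text \<open>Every finite structure is isomorphic to one whose universe is a set of natural numbers, so a
  property is given by its members of type \<^typ>\<open>nat struct\<close>; a structure over any other type has
  the property iff it is isomorphic to one of these.\<close>

definition is_property :: "voc \<Rightarrow> nat struct set \<Rightarrow> bool" where
  "is_property \<tau> \<Phi> \<longleftrightarrow> \<Phi> \<subseteq> Str \<tau> \<and> (\<forall>A\<in>\<Phi>. \<forall>B\<in>Str \<tau>. isomorphic A B \<longrightarrow> B \<in> \<Phi>)"

definition has_property :: "'a struct \<Rightarrow> nat struct set \<Rightarrow> bool" where
  "has_property A \<Phi> \<longleftrightarrow> (\<exists>B\<in>\<Phi>. isomorphic A B)"


section \<open>First order logic with Lindstroem quantifiers\<close>

text \<open>Variables are de Bruijn indices into an environment. In \<open>Quant \<tau> \<Phi> [\<theta>\<^sub>1, \<dots>, \<theta>\<^sub>m] [t\<^sub>1, \<dots>, t\<^sub>l]\<close> the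
  quantifier \<open>Q\<^sub>\<Phi>\<close> of the \<open>\<tau>\<close>-property \<open>\<Phi>\<close> binds the variables \<open>0, \<dots>, r\<^sub>i - 1\<close> of \<open>\<theta>\<^sub>i\<close>, where \<open>r\<^sub>i\<close> is the
  arity of the \<open>i\<close>-th relation symbol of \<open>\<tau>\<close>. The terms \<open>t\<^sub>j\<close>, in which nothing is bound, interpret
  the constant symbols of \<open>\<tau>\<close>; there are none if \<open>\<tau>\<close> is purely relational.\<close>

datatype tm = Var nat | Cst nat

datatype fm =
    Fls
  | Eq tm tm
  | Rel nat "tm list"
  | Neg fm
  | Conj fm fm
  | Ex fm
  | Quant voc "nat struct set" "fm list" "tm list"

primrec tm_val :: "'a struct \<Rightarrow> 'a list \<Rightarrow> tm \<Rightarrow> 'a" where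
  "tm_val A env (Var i) = env ! i"
| "tm_val A env (Cst c) = csts A ! c"

primrec sat :: "'a struct \<Rightarrow> fm \<Rightarrow> 'a list \<Rightarrow> bool" where
  "sat A Fls = (\<lambda>env. False)"
| "sat A (Eq t u) = (\<lambda>env. tm_val A env t = tm_val A env u)"
| "sat A (Rel i ts) = (\<lambda>env. map (tm_val A env) ts \<in> rels A ! i)"
| "sat A (Neg \<phi>) = (\<lambda>env. \<not> sat A \<phi> env)"
| "sat A (Conj \<phi> \<psi>) = (\<lambda>env. sat A \<phi> env \<and> sat A \<psi> env)"
| "sat A (Ex \<phi>) = (\<lambda>env. \<exists>a\<in>univ A. sat A \<phi> (a # env))"
| "sat A (Quant \<tau> \<Phi> \<theta>s ts) = (\<lambda>env. has_property
     (Struct (univ A)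
       (map2 (\<lambda>r P. {as \<in> tuples (univ A) r. P (as @ env)}) (ars \<tau>) (map (sat A) \<theta>s))
       (map (tm_val A env) ts)) \<Phi>)"

primrec is_tm :: "voc \<Rightarrow> nat \<Rightarrow> tm \<Rightarrow> bool" where
  "is_tm \<sigma> n (Var i) \<longleftrightarrow> i < n"
| "is_tm \<sigma> n (Cst c) \<longleftrightarrow> c < ncsts \<sigma>"

text \<open>\<open>is_fm L \<sigma> n \<phi>\<close>: \<open>\<phi>\<close> is a \<open>\<sigma>\<close>-formula with free variables among \<open>0, \<dots>, n - 1\<close> of first order
  logic extended by the quantifiers \<open>Q\<^sub>\<Phi>\<close> for all \<open>\<Phi> \<in> L \<tau>\<close> and all \<open>\<tau>\<close>.\<close>

inductive is_fm :: "(voc \<Rightarrow> nat struct set set) \<Rightarrow> voc \<Rightarrow> nat \<Rightarrow> fm \<Rightarrow> bool"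
  for L :: "voc \<Rightarrow> nat struct set set" and \<sigma> :: voc where
  Fls: "is_fm L \<sigma> n Fls"
| Eq: "is_tm \<sigma> n t \<Longrightarrow> is_tm \<sigma> n u \<Longrightarrow> is_fm L \<sigma> n (Eq t u)"
| Rel: "i < length (ars \<sigma>) \<Longrightarrow> length ts = ars \<sigma> ! i \<Longrightarrow> (\<forall>t\<in>set ts. is_tm \<sigma> n t)
    \<Longrightarrow> is_fm L \<sigma> n (Rel i ts)"
| Neg: "is_fm L \<sigma> n \<phi> \<Longrightarrow> is_fm L \<sigma> n (Neg \<phi>)"
| Conj: "is_fm L \<sigma> n \<phi> \<Longrightarrow> is_fm L \<sigma> n \<psi> \<Longrightarrow> is_fm L \<sigma> n (Conj \<phi> \<psi>)"
| Ex: "is_fm L \<sigma> (Suc n) \<phi> \<Longrightarrow> is_fm L \<sigma> n (Ex \<phi>)"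
| Quant: "\<Phi> \<in> L \<tau> \<Longrightarrow> length \<theta>s = length (ars \<tau>)
    \<Longrightarrow> (\<And>i. i < length \<theta>s \<Longrightarrow> is_fm L \<sigma> (ars \<tau> ! i + n) (\<theta>s ! i))
    \<Longrightarrow> length ts = ncsts \<tau> \<Longrightarrow> (\<forall>t\<in>set ts. is_tm \<sigma> n t)
    \<Longrightarrow> is_fm L \<sigma> n (Quant \<tau> \<Phi> \<theta>s ts)"

primrec quantifier_free :: "fm \<Rightarrow> bool" where
  "quantifier_free Fls \<longleftrightarrow> True"
| "quantifier_free (Eq t u) \<longleftrightarrow> True"
| "quantifier_free (Rel i ts) \<longleftrightarrow> True"
| "quantifier_free (Neg \<phi>) \<longleftrightarrow> quantifier_free \<phi>"
| "quantifier_free (Conj \<phi> \<psi>) \<longleftrightarrow> quantifier_free \<phi> \<and> quantifier_free \<psi>"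
| "quantifier_free (Ex \<phi>) \<longleftrightarrow> False"
| "quantifier_free (Quant \<tau> \<Phi> \<theta>s ts) \<longleftrightarrow> False"

definition is_qf_fm :: "voc \<Rightarrow> nat \<Rightarrow> fm \<Rightarrow> bool" where
  "is_qf_fm \<sigma> n \<phi> \<longleftrightarrow> is_fm (\<lambda>_. {}) \<sigma> n \<phi> \<and> quantifier_free \<phi>"

definition models :: "voc \<Rightarrow> fm \<Rightarrow> nat struct set" where
  "models \<tau> \<phi> = {A \<in> Str \<tau>. sat A \<phi> []}"

definition lindstrom_logic :: "(voc \<Rightarrow> nat struct set set) \<Rightarrow> bool" where
  "lindstrom_logic L \<longleftrightarrow> (\<forall>\<tau>. \<forall>\<Phi>\<in>L \<tau>. is_property \<tau> \<Phi>)
     \<and> (\<forall>\<tau>. L \<tau> = {models \<tau> \<phi> |\<phi>. is_fm L \<tau> 0 \<phi>})"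


section \<open>Transductions, sum-like and product-like operations\<close>

text \<open>\<open>Scheme k \<phi> [\<phi>\<^sub>1, \<dots>, \<phi>\<^sub>m] [\<kappa>\<^sub>1, \<dots>, \<kappa>\<^sub>l]\<close> is a \<open>k\<close>-vectorized translation scheme. Elements of the new
  structure are \<open>k\<close>-tuples of old elements, so if the target vocabulary has constant symbols, each
  of them is assigned a \<open>k\<close>-tuple \<open>\<kappa>\<^sub>j\<close> of constant symbols of the source vocabulary.\<close>

datatype scheme = Scheme (dim: nat) (dom_fm: fm) (rel_fms: "fm list") (cst_tuples: "nat list list")

definition is_scheme :: "voc \<Rightarrow> voc \<Rightarrow> scheme \<Rightarrow> bool" where
  "is_scheme \<sigma> \<tau> T \<longleftrightarrow> dim T \<ge> 1
     \<and> is_qf_fm \<sigma> (dim T) (dom_fm T)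
     \<and> length (rel_fms T) = length (ars \<tau>)
     \<and> (\<forall>i<length (ars \<tau>). is_qf_fm \<sigma> (dim T * ars \<tau> ! i) (rel_fms T ! i))
     \<and> length (cst_tuples T) = ncsts \<tau>
     \<and> (\<forall>\<kappa>\<in>set (cst_tuples T). length \<kappa> = dim T \<and> (\<forall>c\<in>set \<kappa>. c < ncsts \<sigma>))"

definition transduct :: "voc \<Rightarrow> scheme \<Rightarrow> 'a struct \<Rightarrow> 'a list struct" where
  "transduct \<tau> T A = (let U = {as \<in> tuples (univ A) (dim T). sat A (dom_fm T) as} in
     Struct U
       (map2 (\<lambda>r \<phi>. {xs \<in> tuples U r. sat A \<phi> (concat xs)}) (ars \<tau>) (rel_fms T))
       (map (map (\<lambda>c. csts A ! c)) (cst_tuples T)))"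

text \<open>If \<open>\<sigma>\<close> has constant symbols \<open>0, \<dots>, l - 1\<close>, then those of the disjoint union are \<open>0, \<dots>, l - 1\<close>,
  coming from the first structure, and \<open>l, \<dots>, 2 l - 1\<close>, coming from the second.\<close>

definition disj_union_voc :: "voc \<Rightarrow> voc" where
  "disj_union_voc \<sigma> = Voc (ars \<sigma>) (2 * ncsts \<sigma>)"

definition disj_union :: "'a struct \<Rightarrow> 'b struct \<Rightarrow> ('a + 'b) struct" where
  "disj_union A B = Struct (univ A <+> univ B)
     (map2 (\<lambda>R S. map Inl ` R \<union> map Inr ` S) (rels A) (rels B))
     (map Inl (csts A) @ map Inr (csts B))"

text \<open>That the result lies in \<open>Str \<tau>\<close> is a restriction only if \<open>\<tau>\<close> has constant symbols: their
  interpretations must belong to the universe defined by the scheme.\<close>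

definition induces :: "voc \<Rightarrow> voc \<Rightarrow> scheme
    \<Rightarrow> (nat struct \<Rightarrow> nat struct \<Rightarrow> (nat + nat) list struct) \<Rightarrow> bool" where
  "induces \<sigma> \<tau> T op \<longleftrightarrow> is_scheme (disj_union_voc \<sigma>) \<tau> T
     \<and> (\<forall>A\<in>Str \<sigma>. \<forall>B\<in>Str \<sigma>. op A B = transduct \<tau> T (disj_union A B) \<and> op A B \<in> Str \<tau>)"

definition sum_like :: "voc \<Rightarrow> voc
    \<Rightarrow> (nat struct \<Rightarrow> nat struct \<Rightarrow> (nat + nat) list struct) \<Rightarrow> bool" where
  "sum_like \<sigma> \<tau> op \<longleftrightarrow> (\<exists>T. dim T = 1 \<and> induces \<sigma> \<tau> T op)"

definition product_like :: "voc \<Rightarrow> voc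
    \<Rightarrow> (nat struct \<Rightarrow> nat struct \<Rightarrow> (nat + nat) list struct) \<Rightarrow> bool" where
  "product_like \<sigma> \<tau> op \<longleftrightarrow> (\<exists>T. induces \<sigma> \<tau> T op)"


section \<open>Hankel matrices and their rank\<close>

definition hankel :: "nat struct set \<Rightarrow> (nat struct \<Rightarrow> nat struct \<Rightarrow> 'c struct)
    \<Rightarrow> nat struct \<Rightarrow> nat struct \<Rightarrow> bit" where
  "hankel \<Phi> op A B = (if has_property (op A B) \<Phi> then 1 else 0)"

definition bit_scale :: "bit \<Rightarrow> ('b \<Rightarrow> bit) \<Rightarrow> 'b \<Rightarrow> bit" where
  "bit_scale c v = (\<lambda>x. c * v x)"

interpretation bit_vec: vector_space "bit_scale :: bit \<Rightarrow> ('b \<Rightarrow> bit) \<Rightarrow> 'b \<Rightarrow> bit"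
  by standard (simp_all only: bit_scale_def fun_eq_iff plus_fun_apply distrib_left distrib_right
      mult.assoc mult_1_left simp_thms)

definition bit_rows :: "'a set \<Rightarrow> 'b set \<Rightarrow> ('a \<Rightarrow> 'b \<Rightarrow> bit) \<Rightarrow> ('b \<Rightarrow> bit) set" where
  "bit_rows I J M = (\<lambda>i j. if j \<in> J then M i j else 0) ` I"

definition bit_rank :: "'a set \<Rightarrow> 'b set \<Rightarrow> ('a \<Rightarrow> 'b \<Rightarrow> bit) \<Rightarrow> enat" where
  "bit_rank I J M =
     (SUP V \<in> {V. V \<subseteq> bit_rows I J M \<and> finite V \<and> bit_vec.independent V}. enat (card V))"

definition finite_S_rank :: "voc \<Rightarrow> nat struct set \<Rightarrow> bool" where
  "finite_S_rank \<tau> \<Phi> \<longleftrightarrow>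
     (\<forall>\<sigma> op. sum_like \<sigma> \<tau> op \<longrightarrow> bit_rank (Str \<sigma>) (Str \<sigma>) (hankel \<Phi> op) < \<infinity>)"

definition finite_P_rank :: "voc \<Rightarrow> nat struct set \<Rightarrow> bool" where
  "finite_P_rank \<tau> \<Phi> \<longleftrightarrow>
     (\<forall>\<sigma> op. product_like \<sigma> \<tau> op \<longrightarrow> bit_rank (Str \<sigma>) (Str \<sigma>) (hankel \<Phi> op) < \<infinity>)"

definition logic_finite_S_rank :: "(voc \<Rightarrow> nat struct set set) \<Rightarrow> bool" where
  "logic_finite_S_rank L \<longleftrightarrow> (\<forall>\<tau>. \<forall>\<Phi>\<in>L \<tau>. finite_S_rank \<tau> \<Phi>)"

definition logic_finite_P_rank :: "(voc \<Rightarrow> nat struct set set) \<Rightarrow> bool" where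
  "logic_finite_P_rank L \<longleftrightarrow> (\<forall>\<tau>. \<forall>\<Phi>\<in>L \<tau>. finite_P_rank \<tau> \<Phi>)"

definition S_properties :: "voc \<Rightarrow> nat struct set set" where
  "S_properties \<tau> = {\<Phi>. is_property \<tau> \<Phi> \<and> finite_S_rank \<tau> \<Phi>}"

definition P_properties :: "voc \<Rightarrow> nat struct set set" where
  "P_properties \<tau> = {\<Phi>. is_property \<tau> \<Phi> \<and> finite_P_rank \<tau> \<Phi>}"

end

theory Submission
  imports Defs
begin

text \<open>Over the two-element field a matrix has finite rank iff it has finitely many distinct rows. A property \<open>\<Phi>\<close>
  has finite rank, therefore, iff for each admissible operation \<open>\<box>\<close> the truth of \<open>A \<box> B \<in> \<Phi>\<close> depends on \<open>A\<close> only
  through one of finitely many types. In this form both halves of the theorem have one proof, carried out for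
  an arbitrary set \<open>K\<close> of admissible dimensions of translation schemes: \<open>K = {1}\<close> gives sum-like and
  \<open>K = UNIV\<close> gives product-like operations.

  A property \<open>\<Phi>\<close> of finite rank is definable: \<open>Q\<^sub>\<Phi>\<close> applied to the atomic formulas of its vocabulary defines it.
  The work lies in the converse, that a property defined by means of quantifiers \<open>Q\<^sub>\<Phi>\<close> with \<open>\<Phi>\<close> of finite rank
  has finite rank. This goes by induction on the formula \<open>\<theta>\<close>, and the statement that is inductive speaks about free
  variables. An assignment in \<open>A \<box> B\<close> is a tuple over the disjoint union of the universes; once it is fixed which
  entries come from \<open>A\<close>, it is given by a tuple \<open>x\<close> over \<open>A\<close> and a tuple \<open>y\<close> over \<open>B\<close>. The claim is that the matrix
  with rows \<open>(A, x)\<close>, columns \<open>(B, y)\<close> and entries ``\<open>\<theta>\<close> holds in \<open>A \<box> B\<close> at the tuple merged from \<open>x\<close> and \<open>y\<close>'' has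
  finitely many rows, for each pattern of merging. Quantifier-free formulas satisfy this because an atomic
  formula over a disjoint union is decided by one side. A row for \<open>\<exists>z \<theta>\<close> is determined by the
  set of rows for \<open>\<theta>\<close> that occur when \<open>x\<close> is extended.

  For \<open>Q\<^sub>\<Phi> (\<theta>\<^sub>1, \<dots>, \<theta>\<^sub>m)\<close> the finitely many rows of the matrices of the \<open>\<theta>\<^sub>i\<close> become new relation symbols. The structure
  \<open>A\<close> is replaced by \<open>A*\<close>, which records for each row \<open>t\<close> the tuples \<open>x\<close> with row \<open>t\<close>, and \<open>B\<close> is replaced by \<open>B*\<close>,
  which records for each \<open>t\<close> the tuples \<open>y\<close> at which \<open>t\<close> has the entry 1. Then \<open>\<theta>\<^sub>i\<close> is a quantifier-free formula over
  \<open>A* \<squnion> B*\<close>, a finite disjunction over patterns and rows. The structure to which \<open>Q\<^sub>\<Phi>\<close> is applied is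
  thus \<open>A* \<box>* B*\<close> for a new operation \<open>\<box>*\<close> of the same dimension, so finite rank of \<open>\<Phi>\<close> yields finitely many rows.
  The locale \<open>type_expansion\<close> contains this coding, \<open>few_rows_quantifier\<close> concludes from it, and
  \<open>split_family_formula\<close> is the induction.

  Empty structures have no elements to interpret the auxiliary constants of \<open>A*\<close>. The
  argument is therefore run on nonempty structures, and the empty ones, of which there are finitely many, are added
  at the end.\<close>

section \<open>Matrices with finitely many rows\<close>

definition few_rows :: "'i set \<Rightarrow> 'j set \<Rightarrow> ('i \<Rightarrow> 'j \<Rightarrow> bool) \<Rightarrow> bool" where
  "few_rows I J M \<longleftrightarrow> finite ((\<lambda>i. {j \<in> J. M i j}) ` I)"

text \<open>The source of all finiteness below: it suffices to find an invariant \<open>c\<close> of the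
  row indices that takes finitely many values and determines the row.\<close>

lemma few_rowsI:
  assumes fin: "finite (c ` I)"
    and det: "\<And>i i' j. i \<in> I \<Longrightarrow> i' \<in> I \<Longrightarrow> j \<in> J \<Longrightarrow> c i = c i' \<Longrightarrow> M i j \<Longrightarrow> M i' j"
  shows "few_rows I J M"
proof -
  let ?r = "\<lambda>i. {j \<in> J. M i j}"
  have "?r i = ?r (inv_into I c (c i))" if "i \<in> I" for i
  proof -
    have "inv_into I c (c i) \<in> I" "c (inv_into I c (c i)) = c i"
      using that by (auto intro: inv_into_into f_inv_into_f)
    then show ?thesis using det[OF that] det[OF _ that] by auto
  qed
  then have "?r ` I \<subseteq> (\<lambda>z. ?r (inv_into I c z)) ` c ` I" by auto
  then show ?thesis unfolding few_rows_def using fin finite_surj by blast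
qed

lemma few_rowsD:
  "few_rows I J M \<Longrightarrow> finite ((\<lambda>i. {j \<in> J. M i j}) ` I)"
  by (simp add: few_rows_def)

lemma few_rows_cong:
  assumes "few_rows I J M" "\<And>i j. i \<in> I \<Longrightarrow> j \<in> J \<Longrightarrow> M' i j = M i j"
  shows "few_rows I J M'"
proof -
  have "(\<lambda>i. {j \<in> J. M' i j}) ` I = (\<lambda>i. {j \<in> J. M i j}) ` I"
    using assms(2) by (intro image_cong) auto
  then show ?thesis using assms(1) by (simp add: few_rows_def)
qed

lemma few_rows_row: "few_rows I J (\<lambda>i j. P i)"
  by (rule few_rowsI[where c = P]) (auto intro: finite_subset[of _ UNIV])

lemma few_rows_col: "few_rows I J (\<lambda>i j. P j)"
  by (rule few_rowsI[where c = "\<lambda>_. ()"]) auto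

lemma few_rows_Not:
  assumes "few_rows I J M"
  shows "few_rows I J (\<lambda>i j. \<not> M i j)"
  by (rule few_rowsI[OF few_rowsD[OF assms]]) (auto simp: set_eq_iff)

lemma few_rows_conj:
  assumes "few_rows I J M" "few_rows I J N"
  shows "few_rows I J (\<lambda>i j. M i j \<and> N i j)"
proof (rule few_rowsI[where c = "\<lambda>i. ({j \<in> J. M i j}, {j \<in> J. N i j})"])
  show "finite ((\<lambda>i. ({j \<in> J. M i j}, {j \<in> J. N i j})) ` I)"
    by (rule finite_subset[OF _ finite_cartesian_product[OF few_rowsD[OF assms(1)] few_rowsD[OF assms(2)]]])
       auto
qed (auto simp: set_eq_iff)

lemma few_rows_disj:
  assumes "few_rows I J M" "few_rows I J N"
  shows "few_rows I J (\<lambda>i j. M i j \<or> N i j)"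
  using few_rows_Not[OF few_rows_conj[OF few_rows_Not[OF assms(1)] few_rows_Not[OF assms(2)]]]
  by simp

lemma few_rows_all:
  assumes "finite Q" "\<And>q. q \<in> Q \<Longrightarrow> few_rows I J (M q)"
  shows "few_rows I J (\<lambda>i j. \<forall>q\<in>Q. M q i j)"
  using assms
proof (induction Q rule: finite_induct)
  case empty
  then show ?case using few_rows_row[of I J "\<lambda>_. True"] by simp
next
  case (insert q Q)
  have "few_rows I J (\<lambda>i j. M q i j \<and> (\<forall>q\<in>Q. M q i j))"
    using insert by (intro few_rows_conj) auto
  then show ?case by simp
qed

lemma few_rows_reindex:
  assumes "few_rows I J M" "\<And>i. i \<in> I' \<Longrightarrow> \<alpha> i \<in> I" "\<And>j. j \<in> J' \<Longrightarrow> \<beta> j \<in> J"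
  shows "few_rows I' J' (\<lambda>i j. M (\<alpha> i) (\<beta> j))"
proof (rule few_rowsI[where c = "\<lambda>i. {j \<in> J. M (\<alpha> i) j}"])
  show "finite ((\<lambda>i. {j \<in> J. M (\<alpha> i) j}) ` I')"
    by (rule finite_subset[OF _ few_rowsD[OF assms(1)]]) (use assms(2) in auto)
qed (use assms(3) in \<open>auto simp: set_eq_iff\<close>)

text \<open>Finitely many new columns multiply the number of rows by a finite factor, and finitely many new rows
  add to it.\<close>

lemma few_rows_cofinite:
  assumes "few_rows I J M" "finite (I' - I)" "finite (J' - J)"
  shows "few_rows I' J' M"
proof (rule few_rowsI[where c = "\<lambda>i. (if i \<in> I then None else Some i, {j \<in> J. M i j}, {j \<in> J' - J. M i j})"])
  let ?c = "\<lambda>i. (if i \<in> I then None else Some i, {j \<in> J. M i j}, {j \<in> J' - J. M i j})"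
  have "?c ` I' \<subseteq> ?c ` (I' - I) \<union> {None} \<times> (\<lambda>i. {j \<in> J. M i j}) ` I \<times> Pow (J' - J)"
  proof
    fix z assume "z \<in> ?c ` I'"
    then obtain i where "i \<in> I'" "z = ?c i" by blast
    then show "z \<in> ?c ` (I' - I) \<union> {None} \<times> (\<lambda>i. {j \<in> J. M i j}) ` I \<times> Pow (J' - J)"
      by (cases "i \<in> I") auto
  qed
  then show "finite (?c ` I')"
    using assms few_rowsD[OF assms(1)] by (elim finite_subset) auto
next
  fix i i' j
  assume "i \<in> I'" "i' \<in> I'" "j \<in> J'" "M i j"
    and *: "(if i \<in> I then None else Some i, {j \<in> J. M i j}, {j \<in> J' - J. M i j})
      = (if i' \<in> I then None else Some i', {j \<in> J. M i' j}, {j \<in> J' - J. M i' j})"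
  then have "j \<in> {j \<in> J. M i j} \<union> {j \<in> J' - J. M i j}" by auto
  also have "\<dots> = {j \<in> J. M i' j} \<union> {j \<in> J' - J. M i' j}"
    using * by (simp only: prod.inject)
  finally show "M i' j" by auto
qed

section \<open>Rank over the two-element field\<close>

lemma bit_vec_finite_span:
  assumes "finite (V :: ('b \<Rightarrow> bit) set)"
  shows "finite (bit_vec.span V)"
  using assms
proof (induction V rule: finite_induct)
  case empty
  then show ?case by simp
next
  case (insert v V)
  have "bit_vec.span (insert v V) \<subseteq> (\<lambda>(c, x). bit_scale c v + x) ` ({0, 1} \<times> bit_vec.span V)"
  proof
    fix x assume "x \<in> bit_vec.span (insert v V)"
    then obtain c where c: "x - bit_scale c v \<in> bit_vec.span V"
      using bit_vec.span_breakdown_eq by blast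
    have "c \<in> {0, 1}" by (cases c) auto
    moreover have "x = (\<lambda>(c, x). bit_scale c v + x) (c, x - bit_scale c v)" by simp
    ultimately show "x \<in> (\<lambda>(c, x). bit_scale c v + x) ` ({0, 1} \<times> bit_vec.span V)"
      using c by blast
  qed
  then show ?case using insert.IH by (elim finite_subset) auto
qed

text \<open>Finite rank means that the rows lie in the span of finitely many of them, and over a finite field
  such a span is finite.\<close>

lemma bit_rank_finite_iff_finite_rows:
  "bit_rank I J M < \<infinity> \<longleftrightarrow> finite (bit_rows I J M)"
proof
  assume fin: "finite (bit_rows I J M)"
  have "bit_rank I J M \<le> enat (card (bit_rows I J M))"
    unfolding bit_rank_def by (rule SUP_least) (auto intro: card_mono fin)
  then show "bit_rank I J M < \<infinity>" using le_less_trans by fastforce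
next
  assume "bit_rank I J M < \<infinity>"
  then obtain n where n: "bit_rank I J M = enat n" by (metis less_infinityE)
  obtain V where V: "V \<subseteq> bit_rows I J M" "bit_vec.independent V"
      "bit_rows I J M \<subseteq> bit_vec.span V"
    using bit_vec.maximal_independent_subset by blast
  have "finite V"
  proof (rule ccontr)
    assume "infinite V"
    then obtain W where W: "W \<subseteq> V" "finite W" "card W = Suc n"
      using infinite_arbitrarily_large by blast
    then have "bit_vec.independent W" using V(2) bit_vec.independent_mono by blast
    then have "enat (card W) \<le> bit_rank I J M"
      unfolding bit_rank_def using W V(1) by (intro SUP_upper) auto
    then show False using n W(3) by simp
  qed
  then show "finite (bit_rows I J M)"
    using V(3) bit_vec_finite_span finite_subset by blast
qed

lemma finite_bit_rows_iff_few_rows: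
  "finite (bit_rows I J (\<lambda>i j. if M i j then 1 else 0)) \<longleftrightarrow> few_rows I J M"
proof -
  let ?ind = "\<lambda>S j. if j \<in> S then 1 else (0 :: bit)"
  have rows: "bit_rows I J (\<lambda>i j. if M i j then 1 else 0) = ?ind ` (\<lambda>i. {j \<in> J. M i j}) ` I"
    unfolding bit_rows_def image_image by (intro image_cong) auto
  have "inj ?ind"
    by (rule inj_on_inverseI[where g = "\<lambda>v. {j. v j = 1}"]) (auto split: if_splits)
  then show ?thesis
    unfolding rows few_rows_def by (intro finite_image_iff inj_on_subset[OF \<open>inj ?ind\<close>]) auto
qed

abbreviation op_of :: "voc \<Rightarrow> scheme \<Rightarrow> nat struct \<Rightarrow> nat struct \<Rightarrow> (nat + nat) list struct" where
  "op_of \<tau> T \<equiv> (\<lambda>A B. transduct \<tau> T (disj_union A B))"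

text \<open>Both notions of finite rank at once: \<open>K\<close> is the set of dimensions allowed for the scheme.\<close>

definition finite_rank :: "nat set \<Rightarrow> voc \<Rightarrow> nat struct set \<Rightarrow> bool" where
  "finite_rank K \<tau> \<Phi> \<longleftrightarrow> (\<forall>\<sigma> T. dim T \<in> K \<longrightarrow> induces \<sigma> \<tau> T (op_of \<tau> T)
     \<longrightarrow> few_rows (Str \<sigma>) (Str \<sigma>) (\<lambda>A B. has_property (op_of \<tau> T A B) \<Phi>))"

lemma bit_rank_hankel_finite_iff:
  assumes "induces \<sigma> \<tau> T op"
  shows "bit_rank (Str \<sigma>) (Str \<sigma>) (hankel \<Phi> op) < \<infinity>
    \<longleftrightarrow> few_rows (Str \<sigma>) (Str \<sigma>) (\<lambda>A B. has_property (op_of \<tau> T A B) \<Phi>)"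
proof -
  have "bit_rows (Str \<sigma>) (Str \<sigma>) (hankel \<Phi> op) = bit_rows (Str \<sigma>) (Str \<sigma>)
    (\<lambda>A B. if has_property (op_of \<tau> T A B) \<Phi> then 1 else 0)"
    unfolding bit_rows_def
    by (intro image_cong) (use assms in \<open>auto simp: induces_def hankel_def\<close>)
  then show ?thesis
    by (simp only: bit_rank_finite_iff_finite_rows finite_bit_rows_iff_few_rows)
qed

lemma induces_op_of: "induces \<sigma> \<tau> T op \<Longrightarrow> induces \<sigma> \<tau> T (op_of \<tau> T)"
  unfolding induces_def by metis

lemma finite_S_rank_iff: "finite_S_rank \<tau> \<Phi> \<longleftrightarrow> finite_rank {1} \<tau> \<Phi>"
proof
  assume "finite_S_rank \<tau> \<Phi>"
  then show "finite_rank {1} \<tau> \<Phi>"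
    unfolding finite_S_rank_def sum_like_def finite_rank_def
    using bit_rank_hankel_finite_iff by blast
next
  assume "finite_rank {1} \<tau> \<Phi>"
  then show "finite_S_rank \<tau> \<Phi>"
    unfolding finite_S_rank_def sum_like_def finite_rank_def
    using bit_rank_hankel_finite_iff induces_op_of by blast
qed

lemma finite_P_rank_iff: "finite_P_rank \<tau> \<Phi> \<longleftrightarrow> finite_rank UNIV \<tau> \<Phi>"
proof
  assume "finite_P_rank \<tau> \<Phi>"
  then show "finite_rank UNIV \<tau> \<Phi>"
    unfolding finite_P_rank_def product_like_def finite_rank_def
    using bit_rank_hankel_finite_iff by blast
next
  assume "finite_rank UNIV \<tau> \<Phi>"
  then show "finite_P_rank \<tau> \<Phi>"
    unfolding finite_P_rank_def product_like_def finite_rank_def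
    using bit_rank_hankel_finite_iff induces_op_of by blast
qed

section \<open>Tuples over a disjoint union\<close>

lemma tuples_append: "u \<in> tuples U m \<Longrightarrow> w \<in> tuples U n \<Longrightarrow> u @ w \<in> tuples U (m + n)"
  by (auto simp: tuples_def)

lemma finite_tuples: "finite U \<Longrightarrow> finite (tuples U n)"
  using finite_lists_length_eq[of U n] by (simp add: tuples_def conj_commute)

text \<open>A tuple over a disjoint union splits into a pattern \<open>s\<close>, telling which entries are left ones, and two
  tuples \<open>x\<close> and \<open>y\<close> of the full length. Where \<open>s\<close> selects the other side the entries of \<open>x\<close> and \<open>y\<close> are ignored. Keeping these
  padding entries means that tuples, constants and relation symbols have the same arity for all patterns.\<close>

definition merge :: "bool list \<Rightarrow> 'a list \<Rightarrow> 'b list \<Rightarrow> ('a + 'b) list" where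
  "merge s x y = map2 (\<lambda>b (u, v). if b then Inl u else Inr v) s (zip x y)"

lemma length_merge [simp]: "length (merge s x y) = min (length s) (min (length x) (length y))"
  by (simp add: merge_def)

lemma nth_merge:
  "v < length s \<Longrightarrow> v < length x \<Longrightarrow> v < length y
    \<Longrightarrow> merge s x y ! v = (if s ! v then Inl (x ! v) else Inr (y ! v))"
  by (simp add: merge_def)

lemma merge_append:
  "length s = length x \<Longrightarrow> length s = length y
    \<Longrightarrow> merge (s @ s') (x @ x') (y @ y') = merge s x y @ merge s' x' y'"
  by (simp add: merge_def)

lemma take_merge: "take n (merge s x y) = merge (take n s) (take n x) (take n y)"
  by (simp add: merge_def take_map take_zip)

lemma drop_merge: "drop n (merge s x y) = merge (drop n s) (drop n x) (drop n y)"
  by (simp add: merge_def drop_map drop_zip)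

lemma merge_in_tuples:
  assumes "length s = n" "x \<in> tuples X n" "y \<in> tuples Y n"
  shows "merge s x y \<in> tuples (X <+> Y) n"
proof -
  have "merge s x y ! v \<in> X <+> Y" if "v < n" for v
    using assms that by (auto simp: nth_merge tuples_def subset_iff)
  then show ?thesis using assms by (auto simp: tuples_def in_set_conv_nth)
qed

text \<open>The padding can be chosen: it consists of the given elements \<open>a\<close> and \<open>b\<close> only.\<close>

lemma tuple_is_merge:
  assumes "w \<in> tuples (X <+> Y) n" "a \<in> X" "b \<in> Y"
  obtains s x y where "length s = n" "x \<in> tuples X n" "y \<in> tuples Y n" "w = merge s x y"
    "\<forall>v<n. \<not> s ! v \<longrightarrow> x ! v = a" "\<forall>v<n. s ! v \<longrightarrow> y ! v = b"
proof (rule that)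
  let ?x = "map (\<lambda>z. case z of Inl u \<Rightarrow> u | Inr _ \<Rightarrow> a) w"
  let ?y = "map (\<lambda>z. case z of Inr u \<Rightarrow> u | Inl _ \<Rightarrow> b) w"
  have len: "length w = n" using assms by (simp add: tuples_def)
  show "length (map isl w) = n" using len by simp
  show "?x \<in> tuples X n" using assms by (auto simp: tuples_def)
  show "?y \<in> tuples Y n" using assms by (auto simp: tuples_def)
  show "w = merge (map isl w) ?x ?y"
    using len by (intro nth_equalityI) (auto simp: nth_merge split: sum.split)
  show "\<forall>v<n. \<not> map isl w ! v \<longrightarrow> ?x ! v = a" using len by (auto split: sum.split)
  show "\<forall>v<n. map isl w ! v \<longrightarrow> ?y ! v = b" using len by (auto split: sum.split)
qed

text \<open>In a \<open>k\<close>-vectorized transduction an \<open>n\<close>-tuple of elements is a list of \<open>n\<close> lists of length \<open>k\<close>. Patterns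
  and merging apply to the flat list of length \<open>k * n\<close>, from which \<open>chunks\<close> recovers the elements.\<close>

primrec chunks :: "nat \<Rightarrow> nat \<Rightarrow> 'a list \<Rightarrow> 'a list list" where
  "chunks k 0 w = []"
| "chunks k (Suc n) w = take k w # chunks k n (drop k w)"

lemma length_chunks [simp]: "length (chunks k n w) = n"
  by (induction n arbitrary: w) auto

lemma map_chunks: "map (map h) (chunks k n w) = chunks k n (map h w)"
  by (induction n arbitrary: w) (auto simp: take_map drop_map)

lemma concat_chunks: "length w = k * n \<Longrightarrow> concat (chunks k n w) = w"
  by (induction n arbitrary: w) auto

lemma chunks_concat: "\<forall>v\<in>set ws. length v = k \<Longrightarrow> chunks k (length ws) (concat ws) = ws"
  by (induction ws) auto

lemma chunks_append: "length u = k * r \<Longrightarrow> chunks k (r + n) (u @ w) = chunks k r u @ chunks k n w"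
  by (induction r arbitrary: u) auto

lemma nth_chunks: "i < n \<Longrightarrow> chunks k n w ! i = take k (drop (k * i) w)"
  by (induction n arbitrary: w i) (auto simp: nth_Cons add.commute split: nat.split)

lemma set_chunks: "set (chunks k n w) = (\<lambda>c. take k (drop (k * c) w)) ` {..<n}"
proof -
  have "chunks k n w = map (\<lambda>c. take k (drop (k * c) w)) [0..<n]"
    by (rule nth_equalityI) (simp_all add: nth_chunks)
  then show ?thesis by (simp add: atLeast0LessThan)
qed

lemma chunks_in_tuples:
  "w \<in> tuples Z (k * n) \<Longrightarrow> v \<in> set (chunks k n w) \<Longrightarrow> v \<in> tuples Z k"
proof (induction n arbitrary: w)
  case (Suc n)
  then have "take k w \<in> tuples Z k" "drop k w \<in> tuples Z (k * n)"
    by (auto simp: tuples_def dest: in_set_takeD in_set_dropD)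
  then show ?case using Suc by auto
qed simp

lemma concat_in_tuples:
  "\<forall>v\<in>set ws. v \<in> tuples Z k \<Longrightarrow> concat ws \<in> tuples Z (k * length ws)"
  by (induction ws) (auto simp: tuples_def)

section \<open>Families of structures that split into two sides\<close>

text \<open>The condition that the induction on formulas maintains: for each pattern, a relation \<open>P i j\<close> on tuples over
  \<open>X i <+> Y j\<close> depends on the left index and the left part of the tuple only through finitely many types.\<close>

definition finitely_split :: "'i set \<Rightarrow> 'j set \<Rightarrow> ('i \<Rightarrow> nat set) \<Rightarrow> ('j \<Rightarrow> nat set) \<Rightarrow> nat
    \<Rightarrow> ('i \<Rightarrow> 'j \<Rightarrow> (nat + nat) list \<Rightarrow> bool) \<Rightarrow> bool" where
  "finitely_split I J X Y n P \<longleftrightarrow> (\<forall>s. length s = n \<longrightarrow>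
     few_rows (SIGMA i:I. tuples (X i) n) (SIGMA j:J. tuples (Y j) n)
       (\<lambda>p q. P (fst p) (fst q) (merge s (snd p) (snd q))))"

lemma finitely_splitD:
  "finitely_split I J X Y n P \<Longrightarrow> length s = n \<Longrightarrow>
     few_rows (SIGMA i:I. tuples (X i) n) (SIGMA j:J. tuples (Y j) n)
       (\<lambda>p q. P (fst p) (fst q) (merge s (snd p) (snd q)))"
  by (simp add: finitely_split_def)

lemma few_rows_split:
  assumes "finitely_split I J X Y n P" "length s = n"
    and "\<And>i. i \<in> I' \<Longrightarrow> \<phi> i \<in> I \<and> x i \<in> tuples (X (\<phi> i)) n"
    and "\<And>j. j \<in> J' \<Longrightarrow> \<psi> j \<in> J \<and> y j \<in> tuples (Y (\<psi> j)) n"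
  shows "few_rows I' J' (\<lambda>i j. P (\<phi> i) (\<psi> j) (merge s (x i) (y j)))"
  using few_rows_reindex[OF finitely_splitD[OF assms(1,2)], of I' "\<lambda>i. (\<phi> i, x i)" J' "\<lambda>j. (\<psi> j, y j)"]
    assms(3,4) by simp

lemma few_rows_split_chunks:
  assumes P: "finitely_split I J X Y k P" and s: "length s = k * n"
    and x: "\<And>i. i \<in> I' \<Longrightarrow> \<phi> i \<in> I \<and> x i \<in> tuples (X (\<phi> i)) (k * n)"
    and y: "\<And>j. j \<in> J' \<Longrightarrow> \<psi> j \<in> J \<and> y j \<in> tuples (Y (\<psi> j)) (k * n)"
  shows "few_rows I' J' (\<lambda>i j. \<forall>v\<in>set (chunks k n (merge s (x i) (y j))). P (\<phi> i) (\<psi> j) v)"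
proof -
  let ?sub = "\<lambda>c w. take k (drop (k * c) w)"
  have "few_rows I' J' (\<lambda>i j. \<forall>c\<in>{..<n}. P (\<phi> i) (\<psi> j) (?sub c (merge s (x i) (y j))))"
  proof (rule few_rows_all)
    fix c assume "c \<in> {..<n}"
    then have c: "k + k * c \<le> k * n" using mult_le_mono2[of "Suc c" n k] by simp
    then have "?sub c w \<in> tuples Z k" if "w \<in> tuples Z (k * n)" for w :: "nat list" and Z
      using that by (auto simp: tuples_def dest!: in_set_takeD in_set_dropD)
    then show "few_rows I' J' (\<lambda>i j. P (\<phi> i) (\<psi> j) (?sub c (merge s (x i) (y j))))"
      unfolding take_merge drop_merge using x y c s
      by (intro few_rows_split[OF P]) auto
  qed simp
  then show ?thesis
    by (rule few_rows_cong) (simp add: set_chunks)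
qed

text \<open>An abstraction of \<open>A \<box> B\<close>, where \<open>i\<close> stands for \<open>A\<close> and \<open>j\<close> for \<open>B\<close>. Abstract indices are needed because under
  a quantifier the row index is no longer a structure but a structure together with an assignment. The last clause
  says that each constant is, uniformly in \<open>i\<close> and \<open>j\<close>, a tuple merged from a part that depends on \<open>i\<close> and a part
  that depends on \<open>j\<close>. Constants may fall outside the universe, since a tuple of parameters need not
  satisfy the domain formula.\<close>

definition split_family :: "nat \<Rightarrow> voc \<Rightarrow> 'i set \<Rightarrow> 'j set \<Rightarrow> ('i \<Rightarrow> nat set) \<Rightarrow> ('j \<Rightarrow> nat set)
    \<Rightarrow> ('i \<Rightarrow> 'j \<Rightarrow> (nat + nat) list struct) \<Rightarrow> bool" where
  "split_family k \<tau> I J X Y S \<longleftrightarrow> k \<ge> 1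
     \<and> (\<forall>i\<in>I. finite (X i) \<and> X i \<noteq> {}) \<and> (\<forall>j\<in>J. finite (Y j) \<and> Y j \<noteq> {})
     \<and> (\<forall>i\<in>I. \<forall>j\<in>J. univ (S i j) \<subseteq> tuples (X i <+> Y j) k
          \<and> length (rels (S i j)) = length (ars \<tau>)
          \<and> (\<forall>q<length (ars \<tau>). rels (S i j) ! q \<subseteq> tuples (univ (S i j)) (ars \<tau> ! q)))
     \<and> finitely_split I J X Y k (\<lambda>i j w. w \<in> univ (S i j))
     \<and> (\<forall>q<length (ars \<tau>). finitely_split I J X Y (k * ars \<tau> ! q)
          (\<lambda>i j w. chunks k (ars \<tau> ! q) w \<in> rels (S i j) ! q))
     \<and> (\<exists>s f g. length s = k * ncsts \<tau>
          \<and> (\<forall>i\<in>I. f i \<in> tuples (X i) (k * ncsts \<tau>)) \<and> (\<forall>j\<in>J. g j \<in> tuples (Y j) (k * ncsts \<tau>))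
          \<and> (\<forall>i\<in>I. \<forall>j\<in>J. csts (S i j) = chunks k (ncsts \<tau>) (merge s (f i) (g j))))"

section \<open>Coding rows as relations\<close>

definition big_disj :: "fm list \<Rightarrow> fm" where
  "big_disj \<phi>s = Neg (foldr (\<lambda>\<phi> \<psi>. Conj (Neg \<phi>) \<psi>) \<phi>s (Neg Fls))"

lemma sat_big_disj: "sat A (big_disj \<phi>s) env \<longleftrightarrow> (\<exists>\<phi>\<in>set \<phi>s. sat A \<phi> env)"
proof -
  have "sat A (foldr (\<lambda>\<phi> \<psi>. Conj (Neg \<phi>) \<psi>) \<phi>s (Neg Fls)) env \<longleftrightarrow> (\<forall>\<phi>\<in>set \<phi>s. \<not> sat A \<phi> env)"
    by (induction \<phi>s) auto
  then show ?thesis by (auto simp: big_disj_def)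
qed

lemma is_qf_big_disj:
  assumes "\<And>\<phi>. \<phi> \<in> set \<phi>s \<Longrightarrow> is_qf_fm \<sigma> n \<phi>"
  shows "is_qf_fm \<sigma> n (big_disj \<phi>s)"
proof -
  have "is_qf_fm \<sigma> n (foldr (\<lambda>\<phi> \<psi>. Conj (Neg \<phi>) \<psi>) \<phi>s (Neg Fls))"
    using assms by (induction \<phi>s) (auto simp: is_qf_fm_def intro: is_fm.intros)
  then show ?thesis by (auto simp: is_qf_fm_def big_disj_def intro: is_fm.intros)
qed

definition big_conj :: "fm list \<Rightarrow> fm" where
  "big_conj \<phi>s = foldr Conj \<phi>s (Neg Fls)"

lemma sat_big_conj: "sat A (big_conj \<phi>s) env \<longleftrightarrow> (\<forall>\<phi>\<in>set \<phi>s. sat A \<phi> env)"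
  unfolding big_conj_def by (induction \<phi>s) auto

lemma is_qf_big_conj:
  assumes "\<And>\<phi>. \<phi> \<in> set \<phi>s \<Longrightarrow> is_qf_fm \<sigma> n \<phi>"
  shows "is_qf_fm \<sigma> n (big_conj \<phi>s)"
  unfolding big_conj_def using assms
  by (induction \<phi>s) (auto simp: is_qf_fm_def intro: is_fm.intros)

text \<open>Relations \<open>P 0, \<dots>, P (m - 1)\<close> with finitely many rows are made quantifier-free definable. The list \<open>es\<close> enumerates
  the triples of a relation \<open>p\<close>, a pattern \<open>s\<close> and a row \<open>t\<close> of the corresponding matrix; rows are represented as sets of
  columns. There are \<open>l \<ge> 1\<close> constants, so that constant \<open>0\<close> on either side can serve as padding.\<close>

locale type_expansion =
  fixes I :: "'i set" and J :: "'j set" and X :: "'i \<Rightarrow> nat set" and Y :: "'j \<Rightarrow> nat set"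
    and m :: nat and ar :: "nat \<Rightarrow> nat" and P :: "nat \<Rightarrow> 'i \<Rightarrow> 'j \<Rightarrow> (nat + nat) list \<Rightarrow> bool"
    and l :: nat and cL :: "'i \<Rightarrow> nat list" and cR :: "'j \<Rightarrow> nat list"
    and es :: "(nat \<times> bool list \<times> ('j \<times> nat list) set) list"
  assumes X: "\<And>i. i \<in> I \<Longrightarrow> finite (X i)" and Y: "\<And>j. j \<in> J \<Longrightarrow> finite (Y j)"
    and l: "0 < l"
    and cL: "\<And>i. i \<in> I \<Longrightarrow> cL i \<in> tuples (X i) l"
    and cR: "\<And>j. j \<in> J \<Longrightarrow> cR j \<in> tuples (Y j) l"
    and es: "set es = {(p, s, t). p < m \<and> length s = ar p \<and>
       t \<in> (\<lambda>a. {b \<in> (SIGMA j:J. tuples (Y j) (ar p)). P p (fst a) (fst b) (merge s (snd a) (snd b))})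
             ` (SIGMA i:I. tuples (X i) (ar p))}"
begin

abbreviation row :: "nat \<Rightarrow> bool list \<Rightarrow> 'i \<Rightarrow> nat list \<Rightarrow> ('j \<times> nat list) set" where
  "row p s i x \<equiv> {b \<in> (SIGMA j:J. tuples (Y j) (ar p)). P p i (fst b) (merge s x (snd b))}"

text \<open>Two relation symbols for each triple: the first block speaks about the left structure and is empty on
  the right, the second block conversely.\<close>

definition xvoc :: voc where
  "xvoc = Voc (map (\<lambda>(p, s, t). ar p) es @ map (\<lambda>(p, s, t). ar p) es) l"

definition left :: "'i \<Rightarrow> nat struct" where
  "left i = Struct (X i)
     (map (\<lambda>(p, s, t). {x \<in> tuples (X i) (ar p). row p s i x = t}) es @ map (\<lambda>_. {}) es) (cL i)"

definition right :: "'j \<Rightarrow> nat struct" where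
  "right j = Struct (Y j)
     (map (\<lambda>_. {}) es @ map (\<lambda>(p, s, t). {y \<in> tuples (Y j) (ar p). (j, y) \<in> t}) es) (cR j)"

lemma ncsts_xvoc: "ncsts xvoc = l"
  by (simp add: xvoc_def)

lemma left_in_Str: "i \<in> I \<Longrightarrow> left i \<in> Str xvoc"
  using X cL by (auto simp: Str_def left_def xvoc_def nth_append tuples_def split_beta)

lemma right_in_Str: "j \<in> J \<Longrightarrow> right j \<in> Str xvoc"
  using Y cR by (auto simp: Str_def right_def xvoc_def nth_append tuples_def split_beta)

text \<open>For a triple \<open>(p, s, t)\<close> the formula says that the left part of the tuple has row \<open>t\<close> and that the right
  part is a column in which \<open>t\<close> has the entry 1. Padding positions are filled by the constants \<open>0\<close> and \<open>l\<close>, which are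
  constant \<open>0\<close> of the left and of the right structure. As each symbol is empty on one side, the two atoms also enforce the
  pattern \<open>s\<close>.\<close>

definition entry_fm :: "nat \<Rightarrow> fm" where
  "entry_fm e = (case es ! e of (p, s, t) \<Rightarrow> Conj
     (Rel e (map (\<lambda>v. if s ! v then Var v else Cst 0) [0..<ar p]))
     (Rel (length es + e) (map (\<lambda>v. if s ! v then Cst l else Var v) [0..<ar p])))"

definition type_fm :: "nat \<Rightarrow> fm" where
  "type_fm p = big_disj (map entry_fm (filter (\<lambda>e. fst (es ! e) = p) [0..<length es]))"

lemma is_qf_type_fm: "is_qf_fm (disj_union_voc xvoc) (ar p) (type_fm p)"
proof -
  have "is_qf_fm (disj_union_voc xvoc) (ar p) (entry_fm e)" if h: "e < length es" "fst (es ! e) = p" for e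
  proof -
    obtain s t where e: "es ! e = (p, s, t)" using h(2) by (metis prod.collapse)
    have "entry_fm e = Conj (Rel e (map (\<lambda>v. if s ! v then Var v else Cst 0) [0..<ar p]))
       (Rel (length es + e) (map (\<lambda>v. if s ! v then Cst l else Var v) [0..<ar p]))"
      by (simp add: entry_fm_def e)
    then show ?thesis using h(1) l unfolding is_qf_fm_def
      by (auto intro!: is_fm.intros simp: e disj_union_voc_def xvoc_def nth_append)
  qed
  then show ?thesis unfolding type_fm_def by (intro is_qf_big_disj) auto
qed

lemma rels_left_right:
  assumes "e < length es" "es ! e = (p, s, t)"
  shows "rels (disj_union (left i) (right j)) ! e
      = map Inl ` {x \<in> tuples (X i) (ar p). row p s i x = t}"
    and "rels (disj_union (left i) (right j)) ! (length es + e)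
      = map Inr ` {y \<in> tuples (Y j) (ar p). (j, y) \<in> t}"
  using assms by (auto simp: disj_union_def left_def right_def nth_append)

lemma sat_type_fm:
  assumes i: "i \<in> I" and j: "j \<in> J" and p: "p < m" and w: "w \<in> tuples (X i <+> Y j) (ar p)"
  shows "sat (disj_union (left i) (right j)) (type_fm p) w \<longleftrightarrow> P p i j w"
proof -
  let ?A = "disj_union (left i) (right j)"
  let ?a = "cL i ! 0" and ?b = "cR j ! 0"
  have ab: "?a \<in> X i" "?b \<in> Y j" using cL[OF i] cR[OF j] l by (auto simp: tuples_def)
  have val: "tm_val ?A w (Var v) = w ! v" "tm_val ?A w (Cst 0) = Inl ?a" "tm_val ?A w (Cst l) = Inr ?b" for v
    using cL[OF i] cR[OF j] l by (auto simp: disj_union_def left_def right_def tuples_def nth_append)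
  have lw: "length w = ar p" using w by (simp add: tuples_def)
  have entry: "sat ?A (entry_fm e) w \<longleftrightarrow>
      (\<exists>x\<in>tuples (X i) (ar p). \<exists>y\<in>tuples (Y j) (ar p). row p s i x = t \<and> (j, y) \<in> t \<and>
        map (\<lambda>v. if s ! v then w ! v else Inl ?a) [0..<ar p] = map Inl x \<and>
        map (\<lambda>v. if s ! v then Inr ?b else w ! v) [0..<ar p] = map Inr y)"
    if e: "e < length es" "es ! e = (p, s, t)" for e s t
  proof -
    have "map (tm_val ?A w) (map (\<lambda>v. if s ! v then Var v else Cst 0) [0..<ar p])
        = map (\<lambda>v. if s ! v then w ! v else Inl ?a) [0..<ar p]"
      "map (tm_val ?A w) (map (\<lambda>v. if s ! v then Cst l else Var v) [0..<ar p])
        = map (\<lambda>v. if s ! v then Inr ?b else w ! v) [0..<ar p]"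
      by (simp_all only: map_map comp_def if_distrib[of "tm_val ?A w"] val)
    then show ?thesis
      unfolding entry_fm_def e(2) by (simp only: prod.case sat.simps rels_left_right[OF e]) blast
  qed
  show ?thesis
  proof
    assume "sat ?A (type_fm p) w"
    then obtain e where "e < length es" "fst (es ! e) = p" "sat ?A (entry_fm e) w"
      by (auto simp: type_fm_def sat_big_disj)
    moreover from this obtain s t where e: "es ! e = (p, s, t)" by (cases "es ! e") auto
    ultimately obtain x y where x: "x \<in> tuples (X i) (ar p)" and y: "y \<in> tuples (Y j) (ar p)"
      and t: "row p s i x = t" "(j, y) \<in> t"
      and wx: "map (\<lambda>v. if s ! v then w ! v else Inl ?a) [0..<ar p] = map Inl x"
      and wy: "map (\<lambda>v. if s ! v then Inr ?b else w ! v) [0..<ar p] = map Inr y"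
      using entry by blast
    have ls: "length s = ar p"
      using nth_mem[OF \<open>e < length es\<close>] unfolding e es by auto
    have "w ! v = (if s ! v then Inl (x ! v) else Inr (y ! v))" if "v < ar p" for v
      using arg_cong[OF wx, of "\<lambda>z. z ! v"] arg_cong[OF wy, of "\<lambda>z. z ! v"] that x y
      by (auto simp: tuples_def split: if_splits)
    then have "w = merge s x y"
      using x y ls lw by (intro nth_equalityI) (auto simp: nth_merge tuples_def)
    then show "P p i j w" using t by auto
  next
    assume P: "P p i j w"
    obtain s x y where s: "length s = ar p" and x: "x \<in> tuples (X i) (ar p)"
      and y: "y \<in> tuples (Y j) (ar p)" and wm: "w = merge s x y"
      and da: "\<forall>v<ar p. \<not> s ! v \<longrightarrow> x ! v = ?a" and db: "\<forall>v<ar p. s ! v \<longrightarrow> y ! v = ?b"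
      using tuple_is_merge[OF w ab] .
    have "(p, s, row p s i x) \<in> set es"
      unfolding es using i x s p by (auto intro!: image_eqI[of _ _ "(i, x)"])
    then obtain e where e: "e < length es" "es ! e = (p, s, row p s i x)"
      by (auto simp: in_set_conv_nth)
    have "map (\<lambda>v. if s ! v then w ! v else Inl ?a) [0..<ar p] = map Inl x"
      "map (\<lambda>v. if s ! v then Inr ?b else w ! v) [0..<ar p] = map Inr y"
      using s x y da db unfolding wm by (auto intro!: nth_equalityI simp: tuples_def nth_merge)
    moreover have "(j, y) \<in> row p s i x" using j y P wm by auto
    ultimately have "sat ?A (entry_fm e) w" using entry[OF e] x y by blast
    then show "sat ?A (type_fm p) w" using e by (auto simp: type_fm_def sat_big_disj)
  qed
qed

end

section \<open>Quantifiers of finite rank\<close>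

text \<open>The universe of \<open>S i j\<close> is coded as relation \<open>0\<close> and its \<open>q\<close>-th relation as relation \<open>q + 1\<close>, so that
  \<open>S i j\<close> becomes a quantifier-free transduction of the disjoint union of two expanded structures. The condition on the
  constants belongs to the matrix entry: it excludes the index pairs at which \<open>S i j\<close> is not a structure.\<close>

lemma few_rows_quantifier:
  assumes \<Phi>: "finite_rank K \<tau> \<Phi>" and k: "k \<in> K" and S: "split_family k \<tau> I J X Y S"
  shows "few_rows I J (\<lambda>i j. set (csts (S i j)) \<subseteq> univ (S i j) \<and> has_property (S i j) \<Phi>)"
proof -
  define n where "n = k * ncsts \<tau>"
  obtain s f g where s: "length s = n" and f: "\<And>i. i \<in> I \<Longrightarrow> f i \<in> tuples (X i) n"
    and g: "\<And>j. j \<in> J \<Longrightarrow> g j \<in> tuples (Y j) n"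
    and csts: "\<And>i j. i \<in> I \<Longrightarrow> j \<in> J \<Longrightarrow> csts (S i j) = chunks k (ncsts \<tau>) (merge s (f i) (g j))"
    using S unfolding split_family_def n_def by blast
  have k1: "k \<ge> 1" and X: "\<And>i. i \<in> I \<Longrightarrow> finite (X i)" "\<And>i. i \<in> I \<Longrightarrow> X i \<noteq> {}"
    and Y: "\<And>j. j \<in> J \<Longrightarrow> finite (Y j)" "\<And>j. j \<in> J \<Longrightarrow> Y j \<noteq> {}"
    and U: "\<And>i j. i \<in> I \<Longrightarrow> j \<in> J \<Longrightarrow> univ (S i j) \<subseteq> tuples (X i <+> Y j) k"
    and lR: "\<And>i j. i \<in> I \<Longrightarrow> j \<in> J \<Longrightarrow> length (rels (S i j)) = length (ars \<tau>)"
    and R: "\<And>i j q. i \<in> I \<Longrightarrow> j \<in> J \<Longrightarrow> q < length (ars \<tau>)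
      \<Longrightarrow> rels (S i j) ! q \<subseteq> tuples (univ (S i j)) (ars \<tau> ! q)"
    and dom: "finitely_split I J X Y k (\<lambda>i j w. w \<in> univ (S i j))"
    and rel: "\<And>q. q < length (ars \<tau>) \<Longrightarrow> finitely_split I J X Y (k * ars \<tau> ! q)
          (\<lambda>i j w. chunks k (ars \<tau> ! q) w \<in> rels (S i j) ! q)"
    using S unfolding split_family_def by auto
  define m where "m = Suc (length (ars \<tau>))"
  define ar where "ar = case_nat k (\<lambda>q. k * ars \<tau> ! q)"
  define P where "P = case_nat (\<lambda>i j w. w \<in> univ (S i j)) (\<lambda>q i j w. chunks k (ars \<tau> ! q) w \<in> rels (S i j) ! q)"
  have P: "finitely_split I J X Y (ar p) (P p)" if "p < m" for p
    using that dom rel by (cases p) (auto simp: m_def ar_def P_def)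
  let ?es = "{(p, s, t). p < m \<and> length s = ar p \<and>
       t \<in> (\<lambda>a. {b \<in> (SIGMA j:J. tuples (Y j) (ar p)). P p (fst a) (fst b) (merge s (snd a) (snd b))})
             ` (SIGMA i:I. tuples (X i) (ar p))}"
  have "?es = (SIGMA p:{..<m}. SIGMA s:{s. length s = ar p}.
       (\<lambda>a. {b \<in> (SIGMA j:J. tuples (Y j) (ar p)). P p (fst a) (fst b) (merge s (snd a) (snd b))})
             ` (SIGMA i:I. tuples (X i) (ar p)))"
    by auto
  also have "finite \<dots>"
  proof (intro finite_SigmaI)
    show "finite {s :: bool list. length s = a}" for a
      using finite_lists_length_eq[of "UNIV :: bool set" a] by simp
  qed (auto intro: few_rowsD finitely_splitD[OF P])
  finally have "\<exists>es. set es = ?es" by (rule finite_list)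
  then obtain es where es: "set es = ?es" by (elim exE)
  \<comment> \<open>The head is the padding constant; the remaining constants follow with their indices shifted by one.\<close>
  define cL where "cL i = (SOME a. a \<in> X i) # f i" for i
  define cR where "cR j = (SOME a. a \<in> Y j) # g j" for j
  have cL: "cL i \<in> tuples (X i) (Suc n)" if "i \<in> I" for i
    using f[OF that] X(2)[OF that] by (auto simp: cL_def tuples_def some_in_eq)
  have cR: "cR j \<in> tuples (Y j) (Suc n)" if "j \<in> J" for j
    using g[OF that] Y(2)[OF that] by (auto simp: cR_def tuples_def some_in_eq)
  interpret type_expansion I J X Y m ar P "Suc n" cL cR es
    by unfold_locales (use X Y cL cR es in auto)
  let ?\<sigma> = "disj_union_voc xvoc"
  \<comment> \<open>The constants of the right structure are numbered from \<open>Suc n\<close>, the number of constants of the left one.\<close>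
  define cs where "cs = chunks k (ncsts \<tau>) (map (\<lambda>v. if s ! v then Suc v else Suc n + Suc v) [0..<n])"
  have cs: "length c = k" "\<forall>v\<in>set c. v < ncsts ?\<sigma>" if "c \<in> set cs" for c
  proof -
    have "map (\<lambda>v. if s ! v then Suc v else Suc n + Suc v) [0..<n] \<in> tuples {..<ncsts ?\<sigma>} (k * ncsts \<tau>)"
      unfolding n_def[symmetric] by (auto simp: tuples_def disj_union_voc_def ncsts_xvoc)
    from chunks_in_tuples[OF this that[unfolded cs_def]]
    show "length c = k" "\<forall>v\<in>set c. v < ncsts ?\<sigma>" by (auto simp: tuples_def)
  qed
  \<comment> \<open>An operation must produce a structure for all arguments, also for those that do not code an index.
    The constants are therefore added to the universe; this changes nothing where they already belong to it.\<close>
  define T where "T = Scheme k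
    (big_disj (type_fm 0 # map (\<lambda>c. big_conj (map (\<lambda>v. Eq (Var v) (Cst (c ! v))) [0..<k])) cs))
    (map (\<lambda>q. type_fm (Suc q)) [0..<length (ars \<tau>)]) cs"
  have dom_T: "sat A (dom_fm T) w \<longleftrightarrow> sat A (type_fm 0) w \<or> w \<in> map (\<lambda>c. csts A ! c) ` set cs"
    if "length w = k" for A :: "'x struct" and w
  proof -
    have *: "sat A (big_conj (map (\<lambda>v. Eq (Var v) (Cst (c ! v))) [0..<k])) w
        \<longleftrightarrow> w = map (\<lambda>c. csts A ! c) c" if "c \<in> set cs" for c
      using cs(1)[OF that] \<open>length w = k\<close>
      by (simp add: sat_big_conj list_eq_iff_nth_eq[of w]) (simp add: Ball_def)
    show ?thesis by (simp add: T_def sat_big_disj image_iff * cong: bex_cong)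
  qed
  have scheme: "is_scheme ?\<sigma> \<tau> T"
  proof -
    have "is_qf_fm ?\<sigma> k (big_conj (map (\<lambda>v. Eq (Var v) (Cst (c ! v))) [0..<k]))" if "c \<in> set cs" for c
      using cs[OF that] by (intro is_qf_big_conj) (auto simp: is_qf_fm_def intro!: is_fm.intros)
    moreover have "is_qf_fm ?\<sigma> k (type_fm 0)"
      using is_qf_type_fm[of 0] by (simp add: ar_def)
    ultimately have "is_qf_fm ?\<sigma> k (dom_fm T)"
      unfolding T_def scheme.sel by (intro is_qf_big_disj) auto
    moreover have "is_qf_fm ?\<sigma> (k * ars \<tau> ! q) (rel_fms T ! q)" if "q < length (ars \<tau>)" for q
      using is_qf_type_fm[of "Suc q"] that by (simp add: ar_def T_def)
    ultimately show ?thesis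
      using cs k1 unfolding is_scheme_def by (simp add: T_def) (simp add: cs_def)
  qed
  have "induces xvoc \<tau> T (op_of \<tau> T)"
    unfolding induces_def
  proof (intro conjI scheme ballI refl)
    fix A B :: "nat struct" assume AB: "A \<in> Str xvoc" "B \<in> Str xvoc"
    let ?A = "disj_union A B"
    have fin: "finite (univ ?A)" using AB by (simp add: disj_union_def Str_def)
    have "csts ?A ! c \<in> univ ?A" if "c < ncsts ?\<sigma>" for c
    proof -
      have "csts ?A ! c \<in> set (csts ?A)"
        using AB that by (intro nth_mem) (auto simp: disj_union_def Str_def disj_union_voc_def)
      also have "\<dots> \<subseteq> univ ?A" using AB by (auto simp: disj_union_def Str_def)
      finally show ?thesis .
    qed
    then have "map (\<lambda>c. csts ?A ! c) c \<in> tuples (univ ?A) k" if "c \<in> set cs" for c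
      using cs[OF that] by (auto simp: tuples_def)
    then have sub: "map (\<lambda>c. csts ?A ! c) ` set cs \<subseteq> tuples (univ ?A) k" by blast
    have U: "univ (op_of \<tau> T A B) = {w \<in> tuples (univ ?A) k. sat ?A (dom_fm T) w}"
      by (simp add: transduct_def Let_def T_def)
    have "map (\<lambda>c. csts ?A ! c) ` set cs \<subseteq> univ (op_of \<tau> T A B)"
      using sub dom_T[of _ ?A] unfolding U by (auto simp: tuples_def)
    moreover have "set (csts (op_of \<tau> T A B)) = map (\<lambda>c. csts ?A ! c) ` set cs"
      by (simp add: transduct_def Let_def T_def)
    moreover have "finite (univ (op_of \<tau> T A B))" using fin unfolding U by (simp add: finite_tuples)
    moreover have "length (csts (op_of \<tau> T A B)) = ncsts \<tau>"
      by (simp add: transduct_def Let_def T_def cs_def)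
    moreover have "length (rels (op_of \<tau> T A B)) = length (ars \<tau>)"
      by (simp add: transduct_def Let_def T_def)
    moreover have "rels (op_of \<tau> T A B) ! q \<subseteq> tuples (univ (op_of \<tau> T A B)) (ars \<tau> ! q)"
      if "q < length (ars \<tau>)" for q
      using that by (auto simp: transduct_def Let_def T_def)
    ultimately show "op_of \<tau> T A B \<in> Str \<tau>" by (simp add: Str_def)
  qed
  then have "few_rows (Str xvoc) (Str xvoc) (\<lambda>A B. has_property (op_of \<tau> T A B) \<Phi>)"
    using \<Phi> k unfolding finite_rank_def by (simp add: T_def)
  then have fr: "few_rows I J (\<lambda>i j. has_property (op_of \<tau> T (left i) (right j)) \<Phi>)"
    by (rule few_rows_reindex) (auto intro: left_in_Str right_in_Str)
  have eq: "op_of \<tau> T (left i) (right j) = S i j"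
    if i: "i \<in> I" and j: "j \<in> J" and valid: "set (csts (S i j)) \<subseteq> univ (S i j)" for i j
  proof (rule struct.expand, intro conjI)
    let ?A = "disj_union (left i) (right j)"
    have univA: "univ ?A = X i <+> Y j" by (simp add: disj_union_def left_def right_def)
    have "map (\<lambda>c. csts ?A ! c) (map (\<lambda>v. if s ! v then Suc v else Suc n + Suc v) [0..<n])
        = merge s (f i) (g j)"
      using s f[OF i] g[OF j]
      by (auto intro!: nth_equalityI
          simp: disj_union_def left_def right_def tuples_def nth_merge cL_def cR_def nth_append)
    then show c: "csts (op_of \<tau> T (left i) (right j)) = csts (S i j)"
      using csts[OF i j] by (simp add: transduct_def Let_def T_def cs_def map_chunks)
    have "w \<in> map (\<lambda>c. csts ?A ! c) ` set cs \<longleftrightarrow> w \<in> set (csts (S i j))" for w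
      unfolding c[symmetric] by (simp add: transduct_def Let_def T_def)
    then have D: "sat ?A (dom_fm T) w \<longleftrightarrow> w \<in> univ (S i j)" if "w \<in> tuples (X i <+> Y j) k" for w
      using dom_T[of w ?A] sat_type_fm[OF i j, of 0 w] that valid
      by (auto simp: m_def ar_def P_def tuples_def)
    then show u: "univ (op_of \<tau> T (left i) (right j)) = univ (S i j)"
      using U[OF i j] by (auto simp: transduct_def Let_def T_def univA)
    show "rels (op_of \<tau> T (left i) (right j)) = rels (S i j)"
    proof (rule nth_equalityI)
      show "length (rels (op_of \<tau> T (left i) (right j))) = length (rels (S i j))"
        using lR[OF i j] by (simp add: transduct_def Let_def T_def)
      fix q assume "q < length (rels (op_of \<tau> T (left i) (right j)))"
      then have q: "q < length (ars \<tau>)" by (simp add: transduct_def Let_def T_def)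
      let ?r = "ars \<tau> ! q"
      have "sat ?A (type_fm (Suc q)) (concat ws) \<longleftrightarrow> ws \<in> rels (S i j) ! q"
        if ws: "ws \<in> tuples (univ (S i j)) ?r" for ws
      proof -
        have len: "length ws = ?r" "\<forall>v\<in>set ws. v \<in> tuples (X i <+> Y j) k"
          using ws U[OF i j] by (auto simp: tuples_def)
        then have "concat ws \<in> tuples (X i <+> Y j) (ar (Suc q))"
          using concat_in_tuples[OF len(2)] by (simp add: ar_def)
        from sat_type_fm[OF i j _ this] q
        have "sat ?A (type_fm (Suc q)) (concat ws) \<longleftrightarrow> chunks k ?r (concat ws) \<in> rels (S i j) ! q"
          by (simp add: m_def P_def)
        also have "chunks k ?r (concat ws) = ws"
          using chunks_concat[of ws k] len by (auto simp: tuples_def)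
        finally show ?thesis .
      qed
      then have "{ws \<in> tuples (univ (S i j)) ?r. sat ?A (type_fm (Suc q)) (concat ws)} = rels (S i j) ! q"
        using R[OF i j q] by blast
      moreover have "rels (op_of \<tau> T (left i) (right j)) ! q
          = {ws \<in> tuples (univ (op_of \<tau> T (left i) (right j))) ?r. sat ?A (type_fm (Suc q)) (concat ws)}"
        using q by (simp add: transduct_def Let_def T_def)
      ultimately show "rels (op_of \<tau> T (left i) (right j)) ! q = rels (S i j) ! q"
        unfolding u by simp
    qed
  qed
  have "few_rows I J (\<lambda>i j. \<forall>v\<in>set (chunks k (ncsts \<tau>) (merge s (f i) (g j))). v \<in> univ (S i j))"
    by (rule few_rows_split_chunks[OF dom]) (use s f g in \<open>auto simp: n_def\<close>)
  then have "few_rows I J (\<lambda>i j. set (csts (S i j)) \<subseteq> univ (S i j))"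
    by (rule few_rows_cong) (use csts in auto)
  from few_rows_conj[OF this fr] show ?thesis
    by (rule few_rows_cong) (use eq in auto)
qed

section \<open>Formulas over a split family\<close>

text \<open>The value of a term in flattened form. It applies alike to patterns, to left parts and to right parts, and commutes with
  merging; hence a tuple of terms evaluated in a split family is again merged from two sides.\<close>

primrec sel :: "nat \<Rightarrow> 'a list \<Rightarrow> 'a list \<Rightarrow> tm \<Rightarrow> 'a list" where
  "sel k cs w (Var a) = take k (drop (k * a) w)"
| "sel k cs w (Cst c) = take k (drop (k * c) cs)"

lemma sel_in_tuples:
  assumes "is_tm \<tau> n t" "cs \<in> tuples Z (k * ncsts \<tau>)" "w \<in> tuples Z (k * n)"
  shows "sel k cs w t \<in> tuples Z k"
proof -
  have "take k (drop (k * a) u) \<in> tuples Z k" if "a < m" "u \<in> tuples Z (k * m)" for a m u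
    using chunks_in_tuples[OF that(2), of "chunks k m u ! a"] that(1)
    by (simp add: nth_chunks[symmetric])
  then show ?thesis using assms by (cases t) auto
qed

lemma length_sel:
  "is_tm \<tau> n t \<Longrightarrow> length cs = k * ncsts \<tau> \<Longrightarrow> length w = k * n \<Longrightarrow> length (sel k cs w t) = k"
  using sel_in_tuples[of \<tau> n t cs UNIV k w] by (simp add: tuples_def)

lemma sels_in_tuples:
  assumes "\<forall>t\<in>set ts. is_tm \<tau> n t" "cs \<in> tuples Z (k * ncsts \<tau>)" "w \<in> tuples Z (k * n)"
  shows "concat (map (sel k cs w) ts) \<in> tuples Z (k * length ts)"
  using concat_in_tuples[of "map (sel k cs w) ts" Z k] sel_in_tuples[OF _ assms(2,3)] assms(1) by auto

lemma merge_sel: "sel k (merge s0 f g) (merge s x y) t = merge (sel k s0 s t) (sel k f x t) (sel k g y t)"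
  by (cases t) (simp_all add: take_merge drop_merge)

lemma merge_sels:
  assumes "\<forall>t\<in>set ts. is_tm \<tau> n t"
    and "length s0 = k * ncsts \<tau>" "length f = k * ncsts \<tau>" "length g = k * ncsts \<tau>"
    and "length s = k * n" "length x = k * n" "length y = k * n"
  shows "merge (concat (map (sel k s0 s) ts)) (concat (map (sel k f x) ts)) (concat (map (sel k g y) ts))
    = concat (map (sel k (merge s0 f g) (merge s x y)) ts)"
  using assms(1)
proof (induction ts)
  case (Cons t ts)
  have "length (sel k s0 s t) = k" "length (sel k f x t) = k" "length (sel k g y t) = k"
    using Cons.prems assms(2-) by (auto intro!: length_sel)
  then show ?case using Cons by (simp add: merge_append merge_sel)
qed (simp add: merge_def)

lemma tm_val_sel:
  assumes "is_tm \<tau> n t" "csts A = chunks k (ncsts \<tau>) cs"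
  shows "tm_val A (chunks k n w) t = sel k cs w t"
  using assms by (cases t) (auto simp: nth_chunks)

lemma tm_vals_merge:
  assumes ts: "\<forall>t\<in>set ts. is_tm \<tau> n t" and A: "csts A = chunks k (ncsts \<tau>) (merge s0 f g)"
    and l: "length s0 = k * ncsts \<tau>" "length f = k * ncsts \<tau>" "length g = k * ncsts \<tau>"
     "length s = k * n" "length x = k * n" "length y = k * n"
  shows "map (tm_val A (chunks k n (merge s x y))) ts = chunks k (length ts)
    (merge (concat (map (sel k s0 s) ts)) (concat (map (sel k f x) ts)) (concat (map (sel k g y) ts)))"
proof -
  let ?ws = "map (sel k (merge s0 f g) (merge s x y)) ts"
  have "map (tm_val A (chunks k n (merge s x y))) ts = ?ws"
    using ts A by (auto simp: tm_val_sel)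
  also have "\<dots> = chunks k (length ?ws) (concat ?ws)"
    using ts l by (intro chunks_concat[symmetric]) (auto intro: length_sel)
  finally show ?thesis using merge_sels[OF ts l] by simp
qed

text \<open>Equality of merged tuples is decided entry by entry: within one side only that side matters, and entries
  from different sides are never equal.\<close>

lemma few_rows_merge_eq:
  assumes "length s = k" "length s' = k"
    and "\<And>i. i \<in> I \<Longrightarrow> length (x i) = k \<and> length (x' i) = k"
    and "\<And>j. j \<in> J \<Longrightarrow> length (y j) = k \<and> length (y' j) = k"
  shows "few_rows I J (\<lambda>i j. merge s (x i) (y j) = merge s' (x' i) (y' j))"
proof -
  have "few_rows I J (\<lambda>i j. \<forall>v\<in>{..<k}. if s ! v then s' ! v \<and> x i ! v = x' i ! v
      else \<not> s' ! v \<and> y j ! v = y' j ! v)"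
  proof (rule few_rows_all)
    fix v
    show "few_rows I J (\<lambda>i j. if s ! v then s' ! v \<and> x i ! v = x' i ! v
        else \<not> s' ! v \<and> y j ! v = y' j ! v)"
      by (cases "s ! v") (simp_all add: few_rows_row few_rows_col)
  qed simp
  then show ?thesis
    by (rule few_rows_cong) (use assms in \<open>auto simp: list_eq_iff_nth_eq[of "merge _ _ _"] nth_merge\<close>)
qed

text \<open>The induction on formulas. The matrix entry demands that the assignment lies in the universe, since a merged tuple may violate
  the domain formula.\<close>

lemma split_family_formula:
  assumes S: "split_family k \<tau> I J X Y S" and k: "k \<in> K"
    and cS: "\<And>i j. i \<in> I \<Longrightarrow> j \<in> J \<Longrightarrow> set (csts (S i j)) \<subseteq> univ (S i j)"
    and L: "\<And>\<tau> \<Phi>. \<Phi> \<in> L \<tau> \<Longrightarrow> finite_rank K \<tau> \<Phi>"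
    and \<theta>: "is_fm L \<tau> n \<theta>"
  shows "finitely_split I J X Y (k * n)
    (\<lambda>i j w. set (chunks k n w) \<subseteq> univ (S i j) \<and> sat (S i j) \<theta> (chunks k n w))"
proof -
  obtain s0 f g where s0: "length s0 = k * ncsts \<tau>" and f: "\<And>i. i \<in> I \<Longrightarrow> f i \<in> tuples (X i) (k * ncsts \<tau>)"
    and g: "\<And>j. j \<in> J \<Longrightarrow> g j \<in> tuples (Y j) (k * ncsts \<tau>)"
    and csts: "\<And>i j. i \<in> I \<Longrightarrow> j \<in> J \<Longrightarrow> csts (S i j) = chunks k (ncsts \<tau>) (merge s0 (f i) (g j))"
    using S unfolding split_family_def by blast
  have X: "\<And>i. i \<in> I \<Longrightarrow> X i \<noteq> {}" and Y: "\<And>j. j \<in> J \<Longrightarrow> Y j \<noteq> {}"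
    and U: "\<And>i j. i \<in> I \<Longrightarrow> j \<in> J \<Longrightarrow> univ (S i j) \<subseteq> tuples (X i <+> Y j) k"
    and dom: "finitely_split I J X Y k (\<lambda>i j w. w \<in> univ (S i j))"
    and rel: "\<And>q. q < length (ars \<tau>) \<Longrightarrow> finitely_split I J X Y (k * ars \<tau> ! q)
          (\<lambda>i j w. chunks k (ars \<tau> ! q) w \<in> rels (S i j) ! q)"
    using S unfolding split_family_def by auto
  have valid: "few_rows (SIGMA i:I. tuples (X i) (k * n)) (SIGMA j:J. tuples (Y j) (k * n))
      (\<lambda>p q. set (chunks k n (merge s (snd p) (snd q))) \<subseteq> univ (S (fst p) (fst q)))"
    if "length s = k * n" for s n
    unfolding subset_iff Ball_def[symmetric]
    by (rule few_rows_split_chunks[OF dom]) (use that in auto)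
  have vals: "map (tm_val (S i j) (chunks k n (merge s x y))) ts = chunks k (length ts)
    (merge (concat (map (sel k s0 s) ts)) (concat (map (sel k (f i) x) ts)) (concat (map (sel k (g j) y) ts)))"
    if "\<forall>t\<in>set ts. is_tm \<tau> n t" "length s = k * n" "i \<in> I" "x \<in> tuples (X i) (k * n)"
      "j \<in> J" "y \<in> tuples (Y j) (k * n)" for ts s i j x y n
    using that s0 f[OF that(3)] g[OF that(5)]
    by (intro tm_vals_merge[OF _ csts]) (auto simp: tuples_def)
  have lsel: "length (concat (map (sel k s0 s) ts)) = k * length ts"
    if "\<forall>t\<in>set ts. is_tm \<tau> n t" "length s = k * n" for ts s n
    using sels_in_tuples[OF that(1), of s0 UNIV k s] that(2) s0 by (simp add: tuples_def)
  show ?thesis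
    using \<theta>
  proof (induction rule: is_fm.induct)
    case (Fls n)
    then show ?case unfolding finitely_split_def by (simp add: few_rows_row)
  next
    case (Eq n t u)
    show ?case
      unfolding finitely_split_def sat.simps
    proof (intro allI impI few_rows_conj valid)
      fix s :: "bool list" assume s: "length s = k * n"
      have len: "length (sel k s0 s t) = k" "length (sel k s0 s u) = k"
        using length_sel s0 s Eq by metis+
      have lX: "length (sel k (f i) x t) = k" "length (sel k (f i) x u) = k"
        if "i \<in> I" "x \<in> tuples (X i) (k * n)" for i x
        using length_sel[of \<tau> n _ "f i" k x] f[OF that(1)] that Eq by (simp_all add: tuples_def)
      have lY: "length (sel k (g i) x t) = k" "length (sel k (g i) x u) = k"
        if "i \<in> J" "x \<in> tuples (Y i) (k * n)" for i x
        using length_sel[of \<tau> n _ "g i" k x] g[OF that(1)] that Eq by (simp_all add: tuples_def)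
      have "few_rows (SIGMA i:I. tuples (X i) (k * n)) (SIGMA j:J. tuples (Y j) (k * n))
        (\<lambda>p q. merge (sel k s0 s t) (sel k (f (fst p)) (snd p) t) (sel k (g (fst q)) (snd q) t)
           = merge (sel k s0 s u) (sel k (f (fst p)) (snd p) u) (sel k (g (fst q)) (snd q) u))"
        using len lX lY by (intro few_rows_merge_eq) auto
      then show "few_rows (SIGMA i:I. tuples (X i) (k * n)) (SIGMA j:J. tuples (Y j) (k * n))
        (\<lambda>p q. tm_val (S (fst p) (fst q)) (chunks k n (merge s (snd p) (snd q))) t
          = tm_val (S (fst p) (fst q)) (chunks k n (merge s (snd p) (snd q))) u)"
        by (rule few_rows_cong) (use Eq csts in \<open>auto simp: tm_val_sel merge_sel\<close>)
    qed
  next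
    case (Rel q ts n)
    show ?case
      unfolding finitely_split_def sat.simps
    proof (intro allI impI few_rows_conj valid)
      fix s :: "bool list" assume s: "length s = k * n"
      have ts: "\<forall>t\<in>set ts. is_tm \<tau> n t" using Rel by simp
      have "few_rows (SIGMA i:I. tuples (X i) (k * n)) (SIGMA j:J. tuples (Y j) (k * n))
        (\<lambda>p r. chunks k (ars \<tau> ! q) (merge (concat (map (sel k s0 s) ts))
           (concat (map (sel k (f (fst p)) (snd p)) ts)) (concat (map (sel k (g (fst r)) (snd r)) ts)))
            \<in> rels (S (fst p) (fst r)) ! q)"
        by (rule few_rows_split[OF rel[OF Rel(1)], where \<phi> = fst and \<psi> = fst])
          (use lsel[OF ts s] sels_in_tuples[OF ts f] sels_in_tuples[OF ts g] Rel(2) in auto)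
      then show "few_rows (SIGMA i:I. tuples (X i) (k * n)) (SIGMA j:J. tuples (Y j) (k * n))
        (\<lambda>p r. map (tm_val (S (fst p) (fst r)) (chunks k n (merge s (snd p) (snd r)))) ts
          \<in> rels (S (fst p) (fst r)) ! q)"
        by (rule few_rows_cong) (use vals[OF ts s] Rel(2) in auto)
    qed
  next
    case (Neg n \<phi>)
    show ?case
      unfolding finitely_split_def
    proof (intro allI impI)
      fix s :: "bool list" assume s: "length s = k * n"
      from few_rows_conj[OF valid[OF s] few_rows_Not[OF finitely_splitD[OF Neg.IH s]]]
      show "few_rows (SIGMA i:I. tuples (X i) (k * n)) (SIGMA j:J. tuples (Y j) (k * n))
        (\<lambda>p q. set (chunks k n (merge s (snd p) (snd q))) \<subseteq> univ (S (fst p) (fst q)) \<and>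
          sat (S (fst p) (fst q)) (Neg \<phi>) (chunks k n (merge s (snd p) (snd q))))"
        by (rule few_rows_cong) auto
    qed
  next
    case (Conj n \<phi> \<psi>)
    show ?case
      unfolding finitely_split_def
    proof (intro allI impI)
      fix s :: "bool list" assume s: "length s = k * n"
      from few_rows_conj[OF finitely_splitD[OF Conj.IH(1) s] finitely_splitD[OF Conj.IH(2) s]]
      show "few_rows (SIGMA i:I. tuples (X i) (k * n)) (SIGMA j:J. tuples (Y j) (k * n))
        (\<lambda>p q. set (chunks k n (merge s (snd p) (snd q))) \<subseteq> univ (S (fst p) (fst q)) \<and>
          sat (S (fst p) (fst q)) (Conj \<phi> \<psi>) (chunks k n (merge s (snd p) (snd q))))"
        by (rule few_rows_cong) auto
    qed
  next
    case (Ex n \<phi>)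
    let ?Q = "\<lambda>i j w. set (chunks k (Suc n) w) \<subseteq> univ (S i j) \<and> sat (S i j) \<phi> (chunks k (Suc n) w)"
    let ?I = "SIGMA i:I. tuples (X i) (k * n)" and ?J = "SIGMA j:J. tuples (Y j) (k * n)"
    let ?I1 = "SIGMA i:I. tuples (X i) (k * Suc n)" and ?J1 = "SIGMA j:J. tuples (Y j) (k * Suc n)"
    show ?case
      unfolding finitely_split_def
    proof (intro allI impI)
      fix s :: "bool list" assume s: "length s = k * n"
      \<comment> \<open>The invariant of a row index \<open>(i, x)\<close>: the rows for \<open>\<phi>\<close> of all extensions of \<open>x\<close> by the left part of one
        more element, each with the pattern of that element. It ranges over subsets of a finite set.\<close>
      let ?row = "\<lambda>s' p. {q \<in> ?J1. ?Q (fst p) (fst q) (merge (s' @ s) (snd p) (snd q))}"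
      let ?c = "\<lambda>p. {(s', ?row s' (fst p, x' @ snd p)) |s' x'. length s' = k \<and> x' \<in> tuples (X (fst p)) k}"
      have app: "x' @ x \<in> tuples Z (k * Suc n)" if "x' \<in> tuples Z k" "x \<in> tuples Z (k * n)" for x' x :: "nat list" and Z
        using tuples_append[OF that] by simp
      have chunks: "chunks k (Suc n) (merge (s' @ s) (x' @ x) (y' @ y)) = merge s' x' y' # chunks k n (merge s x y)"
        if "length s' = k" "x' \<in> tuples Z k" "y' \<in> tuples Z' k" for s' x' x y' y Z Z'
        using that by (simp add: merge_append tuples_def)
      show "few_rows ?I ?J
        (\<lambda>p q. set (chunks k n (merge s (snd p) (snd q))) \<subseteq> univ (S (fst p) (fst q)) \<and>
          sat (S (fst p) (fst q)) (Ex \<phi>) (chunks k n (merge s (snd p) (snd q))))"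
      proof (rule few_rowsI[where c = ?c])
        have "finite (SIGMA s':{s'. length s' = k}. ?row s' ` ?I1)"
        proof (rule finite_SigmaI)
          show "finite {s' :: bool list. length s' = k}"
            using finite_lists_length_eq[of "UNIV :: bool set" k] by simp
          show "finite (?row s' ` ?I1)" if "s' \<in> {s'. length s' = k}" for s'
            using few_rowsD[OF finitely_splitD[OF Ex.IH, of "s' @ s"]] that s by simp
        qed
        moreover have "?c p \<subseteq> (SIGMA s':{s'. length s' = k}. ?row s' ` ?I1)" if "p \<in> ?I" for p
        proof -
          have "(fst p, x' @ snd p) \<in> ?I1" if "x' \<in> tuples (X (fst p)) k" for x'
            using \<open>p \<in> ?I\<close> app[OF that] by (auto simp: mem_Sigma_iff)
          then show ?thesis by blast
        qed
        then have "?c ` ?I \<subseteq> Pow (SIGMA s':{s'. length s' = k}. ?row s' ` ?I1)" by blast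
        ultimately show "finite (?c ` ?I)" by (meson finite_Pow_iff finite_subset)
      next
        fix p p2 q assume p: "p \<in> ?I" and p2: "p2 \<in> ?I" and q: "q \<in> ?J" and c: "?c p = ?c p2"
          and sat: "set (chunks k n (merge s (snd p) (snd q))) \<subseteq> univ (S (fst p) (fst q)) \<and>
            sat (S (fst p) (fst q)) (Ex \<phi>) (chunks k n (merge s (snd p) (snd q)))"
        obtain i x i2 x2 j y where eqs: "p = (i, x)" "p2 = (i2, x2)" "q = (j, y)"
          by (cases p, cases p2, cases q)
        have i: "i \<in> I" "x \<in> tuples (X i) (k * n)" "i2 \<in> I" "x2 \<in> tuples (X i2) (k * n)"
          "j \<in> J" "y \<in> tuples (Y j) (k * n)"
          using p p2 q unfolding eqs by auto
        obtain a where a: "a \<in> univ (S i j)" "sat (S i j) \<phi> (a # chunks k n (merge s x y))"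
          using sat unfolding eqs by auto
        obtain u v where "u \<in> X i" "v \<in> Y j" using X Y i by blast
        moreover have "a \<in> tuples (X i <+> Y j) k" using a U i by blast
        ultimately obtain s' x' y' where s': "length s' = k" and x': "x' \<in> tuples (X i) k"
          and y': "y' \<in> tuples (Y j) k" and am: "a = merge s' x' y'"
          using tuple_is_merge by metis
        have y1: "(j, y' @ y) \<in> ?J1" using app[OF y' i(6)] i(5) by (simp only: mem_Sigma_iff)
        have "(s', ?row s' (i, x' @ x)) \<in> ?c p" unfolding eqs using s' x' by auto
        then have "(s', ?row s' (i, x' @ x)) \<in> ?c p2" by (simp only: c)
        then obtain x'' where x'': "x'' \<in> tuples (X i2) k" and r: "?row s' (i, x' @ x) = ?row s' (i2, x'' @ x2)"
          unfolding eqs by auto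
        have "(j, y' @ y) \<in> ?row s' (i, x' @ x)"
          using y1 sat a am unfolding eqs fst_conv snd_conv chunks[OF s' x' y'] mem_Collect_eq by simp
        then have "(j, y' @ y) \<in> ?row s' (i2, x'' @ x2)" by (simp only: r)
        then have "?Q i2 j (merge (s' @ s) (x'' @ x2) (y' @ y))" by simp
        then show "set (chunks k n (merge s (snd p2) (snd q))) \<subseteq> univ (S (fst p2) (fst q)) \<and>
            sat (S (fst p2) (fst q)) (Ex \<phi>) (chunks k n (merge s (snd p2) (snd q)))"
          unfolding eqs fst_conv snd_conv chunks[OF s' x'' y'] by auto
      qed
    qed
  next
    case (Quant \<Phi> \<tau>' \<theta>s n ts)
    show ?case
      unfolding finitely_split_def
    proof (intro allI impI)
      fix s :: "bool list" assume s: "length s = k * n"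
      have ts: "\<forall>t\<in>set ts. is_tm \<tau> n t" and lts: "length ts = ncsts \<tau>'" using Quant by simp_all
      let ?I = "SIGMA i:I. tuples (X i) (k * n)" and ?J = "SIGMA j:J. tuples (Y j) (k * n)"
      define A where "A p q = S (fst p) (fst q)" for p :: "'a \<times> nat list" and q :: "'b \<times> nat list"
      define E where "E p q = chunks k n (merge s (snd p) (snd q))" for p :: "'a \<times> nat list" and q :: "'b \<times> nat list"
      \<comment> \<open>The structures to which \<open>\<Phi>\<close> is applied form a split family whose indices include the assignment. Where the
        assignment is invalid the induction hypothesis gives only falsity, so the relations are made empty there.\<close>
      define S' where "S' p q = Struct (univ (A p q))
         (map2 (\<lambda>r P. {as \<in> tuples (univ (A p q)) r. set (E p q) \<subseteq> univ (A p q) \<and> P (as @ E p q)})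
            (ars \<tau>') (map (sat (A p q)) \<theta>s))
         (map (tm_val (A p q) (E p q)) ts)" for p q
      have "split_family k \<tau>' ?I ?J (\<lambda>p. X (fst p)) (\<lambda>q. Y (fst q)) S'"
        unfolding split_family_def
      proof (intro conjI)
        show "1 \<le> k" "\<forall>p\<in>?I. finite (X (fst p)) \<and> X (fst p) \<noteq> {}" "\<forall>q\<in>?J. finite (Y (fst q)) \<and> Y (fst q) \<noteq> {}"
          using S unfolding split_family_def by auto
        show "\<forall>i\<in>?I. \<forall>j\<in>?J. univ (S' i j) \<subseteq> tuples (X (fst i) <+> Y (fst j)) k \<and>
             length (rels (S' i j)) = length (ars \<tau>') \<and>
             (\<forall>q<length (ars \<tau>'). rels (S' i j) ! q \<subseteq> tuples (univ (S' i j)) (ars \<tau>' ! q))"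
          using U Quant(2) by (auto simp: S'_def A_def)
        show "finitely_split ?I ?J (\<lambda>p. X (fst p)) (\<lambda>q. Y (fst q)) k (\<lambda>i j w. w \<in> univ (S' i j))"
          unfolding finitely_split_def S'_def A_def struct.sel
          by (intro allI impI few_rows_split[OF dom, where \<phi> = "\<lambda>p. fst (fst p)" and \<psi> = "\<lambda>p. fst (fst p)"]) auto
        show "\<forall>q<length (ars \<tau>'). finitely_split ?I ?J (\<lambda>p. X (fst p)) (\<lambda>q. Y (fst q)) (k * ars \<tau>' ! q)
              (\<lambda>i j w. chunks k (ars \<tau>' ! q) w \<in> rels (S' i j) ! q)"
          unfolding finitely_split_def
        proof (intro allI impI)
          fix c s' assume c: "c < length (ars \<tau>')" and s': "length (s' :: bool list) = k * ars \<tau>' ! c"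
          let ?r = "ars \<tau>' ! c"
          let ?I' = "SIGMA p:?I. tuples (X (fst p)) (k * ?r)" and ?J' = "SIGMA q:?J. tuples (Y (fst q)) (k * ?r)"
          let ?Q = "\<lambda>i j w. set (chunks k (?r + n) w) \<subseteq> univ (S i j) \<and> sat (S i j) (\<theta>s ! c) (chunks k (?r + n) w)"
          have IH: "finitely_split I J X Y (k * (?r + n)) ?Q" using Quant.IH[of c] Quant(2) c by simp
          have "few_rows ?I' ?J' (\<lambda>p q. ?Q (fst (fst p)) (fst (fst q))
              (merge (s' @ s) (snd p @ snd (fst p)) (snd q @ snd (fst q))))"
            by (rule few_rows_split[OF IH]) (use s s' in \<open>auto simp: distrib_left intro: tuples_append\<close>)
          then show "few_rows ?I' ?J' (\<lambda>p q. chunks k ?r (merge s' (snd p) (snd q)) \<in> rels (S' (fst p) (fst q)) ! c)"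
          proof (rule few_rows_cong)
            fix p q assume p: "p \<in> ?I'" and q: "q \<in> ?J'"
            have "length (snd p) = k * ?r" "length (snd q) = k * ?r"
              using p q by (auto simp: tuples_def)
            then have "chunks k (?r + n) (merge (s' @ s) (snd p @ snd (fst p)) (snd q @ snd (fst q)))
                = chunks k ?r (merge s' (snd p) (snd q)) @ E (fst p) (fst q)"
              using s' by (simp add: merge_append chunks_append E_def)
            then show "(chunks k ?r (merge s' (snd p) (snd q)) \<in> rels (S' (fst p) (fst q)) ! c) =
              ?Q (fst (fst p)) (fst (fst q)) (merge (s' @ s) (snd p @ snd (fst p)) (snd q @ snd (fst q)))"
              using c Quant(2) by (auto simp: S'_def A_def tuples_def)
          qed
        qed
        show "\<exists>s f g. length s = k * ncsts \<tau>' \<and>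
            (\<forall>i\<in>?I. f i \<in> tuples (X (fst i)) (k * ncsts \<tau>')) \<and>
            (\<forall>j\<in>?J. g j \<in> tuples (Y (fst j)) (k * ncsts \<tau>')) \<and>
            (\<forall>i\<in>?I. \<forall>j\<in>?J. csts (S' i j) = chunks k (ncsts \<tau>') (merge s (f i) (g j)))"
          by (rule exI[of _ "concat (map (sel k s0 s) ts)"],
              rule exI[of _ "\<lambda>p. concat (map (sel k (f (fst p)) (snd p)) ts)"],
              rule exI[of _ "\<lambda>p. concat (map (sel k (g (fst p)) (snd p)) ts)"])
            (use lsel[OF ts s] sels_in_tuples[OF ts f] sels_in_tuples[OF ts g] vals[OF ts s] lts
              in \<open>auto simp: S'_def A_def E_def\<close>)
      qed
      from few_rows_conj[OF valid[OF s] few_rows_quantifier[OF L[OF Quant(1)] k this]]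
      show "few_rows ?I ?J
        (\<lambda>p q. set (chunks k n (merge s (snd p) (snd q))) \<subseteq> univ (S (fst p) (fst q)) \<and>
          sat (S (fst p) (fst q)) (Quant \<tau>' \<Phi> \<theta>s ts) (chunks k n (merge s (snd p) (snd q))))"
      proof (rule few_rows_cong)
        fix p q assume p: "p \<in> ?I" and q: "q \<in> ?J"
        have "sat (A p q) (Quant \<tau>' \<Phi> \<theta>s ts) (E p q) \<longleftrightarrow> set (csts (S' p q)) \<subseteq> univ (S' p q) \<and> has_property (S' p q) \<Phi>"
          if v: "set (E p q) \<subseteq> univ (A p q)"
        proof -
          have "tm_val (A p q) (E p q) t \<in> univ (A p q)" if "t \<in> set ts" for t
          proof (cases t)
            case (Var a)
            then have "a < length (E p q)" using ts that by (auto simp: E_def)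
            then show ?thesis using Var v nth_mem by auto
          next
            case (Cst c)
            have "csts (A p q) ! c \<in> set (csts (A p q))"
              using ts that Cst p q csts by (intro nth_mem) (auto simp: A_def)
            then show ?thesis using cS[of "fst p" "fst q"] p q Cst by (auto simp: A_def)
          qed
          then show ?thesis using v by (auto simp: S'_def)
        qed
        then show "(set (chunks k n (merge s (snd p) (snd q))) \<subseteq> univ (S (fst p) (fst q)) \<and>
          sat (S (fst p) (fst q)) (Quant \<tau>' \<Phi> \<theta>s ts) (chunks k n (merge s (snd p) (snd q)))) =
          (set (chunks k n (merge s (snd p) (snd q))) \<subseteq> univ (S (fst p) (fst q)) \<and>
            set (csts (S' p q)) \<subseteq> univ (S' p q) \<and> has_property (S' p q) \<Phi>)"
          unfolding A_def E_def by blast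
      qed
    qed
  qed
qed

section \<open>Invariance under isomorphism\<close>

text \<open>The part of membership in \<open>Str \<tau>\<close> that makes isomorphism symmetric: an isomorphism can be inverted
  only where the relations and constants live on the universe.\<close>

definition wf_struct :: "'a struct \<Rightarrow> bool" where
  "wf_struct A \<longleftrightarrow> (\<forall>R\<in>set (rels A). \<forall>xs\<in>R. set xs \<subseteq> univ A) \<and> set (csts A) \<subseteq> univ A"

lemma wf_struct_Str: "A \<in> Str \<tau> \<Longrightarrow> wf_struct A"
  by (force simp: Str_def wf_struct_def tuples_def in_set_conv_nth[of _ "rels A"])

lemma isomorphic_trans:
  assumes "isomorphic A B" "isomorphic B C"
  shows "isomorphic A C"
proof -
  obtain h h' where "bij_betw h (univ A) (univ B)" "rels B = map ((`) (map h)) (rels A)" "csts B = map h (csts A)"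
    and "bij_betw h' (univ B) (univ C)" "rels C = map ((`) (map h')) (rels B)" "csts C = map h' (csts B)"
    using assms unfolding isomorphic_def by blast
  then show ?thesis
    unfolding isomorphic_def
    by (intro exI[of _ "h' \<circ> h"]) (auto simp: bij_betw_trans image_image)
qed

lemma isomorphic_sym:
  assumes "wf_struct A" "isomorphic A B"
  shows "isomorphic B A"
proof -
  obtain h where h: "bij_betw h (univ A) (univ B)" and r: "rels B = map ((`) (map h)) (rels A)"
    and c: "csts B = map h (csts A)"
    using assms unfolding isomorphic_def by blast
  let ?g = "inv_into (univ A) h"
  have inv: "map ?g (map h xs) = xs" if "set xs \<subseteq> univ A" for xs
    using that h by (auto simp: bij_betw_def intro!: map_idI)
  have "map ?g ` map h ` R = R" if "R \<in> set (rels A)" for R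
  proof -
    have "map ?g ` map h ` R = (\<lambda>xs. xs) ` R"
      unfolding image_image by (rule image_cong) (use that assms(1) inv in \<open>auto simp: wf_struct_def\<close>)
    then show ?thesis by simp
  qed
  then have "rels A = map ((`) (map ?g)) (rels B)" unfolding r by (auto simp: map_idI)
  moreover have "csts A = map ?g (csts B)"
    unfolding c using assms(1) inv by (simp add: wf_struct_def)
  ultimately show ?thesis unfolding isomorphic_def using bij_betw_inv_into[OF h] by blast
qed

lemma has_property_iso:
  assumes "wf_struct A" "isomorphic A B"
  shows "has_property A \<Phi> \<longleftrightarrow> has_property B \<Phi>"
proof -
  have "isomorphic A C \<longleftrightarrow> isomorphic B C" for C :: "nat struct"
    using isomorphic_trans[OF assms(2), of C] isomorphic_trans[OF isomorphic_sym[OF assms], of C]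
    by (rule iffI[rotated])
  then show ?thesis by (simp add: has_property_def)
qed

lemma has_property_iff_mem:
  assumes "is_property \<tau> \<Phi>" "A \<in> Str \<tau>"
  shows "has_property A \<Phi> \<longleftrightarrow> A \<in> \<Phi>"
proof
  assume "has_property A \<Phi>"
  then obtain B where "B \<in> \<Phi>" "isomorphic B A"
    using isomorphic_sym[OF wf_struct_Str[OF assms(2)]] unfolding has_property_def by blast
  then show "A \<in> \<Phi>" using assms unfolding is_property_def by blast
next
  have "isomorphic A A" unfolding isomorphic_def by (intro exI[of _ id]) (auto intro!: map_idI[symmetric])
  moreover assume "A \<in> \<Phi>"
  ultimately show "has_property A \<Phi>" unfolding has_property_def by blast
qed

lemma sat_iso:
  assumes h: "bij_betw h (univ A) (univ B)" and r: "rels B = map ((`) (map h)) (rels A)"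
    and c: "csts B = map h (csts A)" and A: "A \<in> Str \<tau>"
    and \<theta>: "is_fm L \<tau> n \<theta>" and env: "length env = n" "set env \<subseteq> univ A"
  shows "sat B \<theta> (map h env) \<longleftrightarrow> sat A \<theta> env"
proof -
  have tm: "tm_val B (map h env) t = h (tm_val A env t)" "tm_val A env t \<in> univ A"
    if "is_tm \<tau> n t" "length env = n" "set env \<subseteq> univ A" for t n env
    using that A c by (cases t; auto simp: Str_def subset_iff)+
  have tms: "map (tm_val B (map h env)) ts = map h (map (tm_val A env) ts)"
    if "\<forall>t\<in>set ts. is_tm \<tau> n t" "length env = n" "set env \<subseteq> univ A" for ts n env
    using that tm(1) by auto
  have inj: "inj_on h (univ A)" and im: "h ` univ A = univ B" using h by (auto simp: bij_betw_def)
  have inj_map: "map h xs = map h ys \<longleftrightarrow> xs = ys" if "set xs \<subseteq> univ A" "set ys \<subseteq> univ A" for xs ys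
    using inj_on_map_eq_map[of h xs ys] inj_on_subset[OF inj] that by (metis Un_least)
  have mem: "map h xs \<in> map h ` R \<longleftrightarrow> xs \<in> R" if "set xs \<subseteq> univ A" "\<forall>ys\<in>R. set ys \<subseteq> univ A" for xs R
    using inj_map that by (auto simp: image_iff)
  show ?thesis
    using \<theta> env
  proof (induction arbitrary: env rule: is_fm.induct)
    case (Eq n t u)
    then show ?case using tm inj by (simp add: inj_on_eq_iff)
  next
    case (Rel i ts n)
    have "rels B ! i = map h ` (rels A ! i)" using r Rel.hyps(1) A by (simp add: Str_def)
    moreover have "\<forall>ys\<in>rels A ! i. set ys \<subseteq> univ A"
      using Rel.hyps(1) A by (auto simp: Str_def tuples_def)
    moreover have "set (map (tm_val A env) ts) \<subseteq> univ A" using Rel tm(2) by auto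
    ultimately show ?case unfolding sat.simps tms[OF Rel.hyps(3) Rel.prems] by (simp only: mem)
  next
    case (Ex n \<phi>)
    have "sat B \<phi> (map h (a # env)) \<longleftrightarrow> sat A \<phi> (a # env)" if "a \<in> univ A" for a
      using that Ex.prems by (intro Ex.IH) auto
    then show ?case unfolding sat.simps im[symmetric] by auto
  next
    case (Quant \<Phi> \<tau>' \<theta>s n ts)
    let ?S = "\<lambda>A env. Struct (univ A)
       (map2 (\<lambda>r P. {as \<in> tuples (univ A) r. P (as @ env)}) (ars \<tau>') (map (sat A) \<theta>s))
       (map (tm_val A env) ts)"
    have ts: "\<forall>t\<in>set ts. is_tm \<tau> n t" using Quant by simp
    have "isomorphic (?S A env) (?S B (map h env))"
      unfolding isomorphic_def
    proof (intro exI[of _ h] conjI)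
      show "bij_betw h (univ (?S A env)) (univ (?S B (map h env)))" using h by simp
      show "csts (?S B (map h env)) = map h (csts (?S A env))" using tms[OF ts Quant.prems] by simp
      show "rels (?S B (map h env)) = map ((`) (map h)) (rels (?S A env))"
      proof (rule nth_equalityI)
        fix i assume "i < length (rels (?S B (map h env)))"
        then have i: "i < length (ars \<tau>')" "i < length \<theta>s" by auto
        have sat: "sat B (\<theta>s ! i) (map h as @ map h env) \<longleftrightarrow> sat A (\<theta>s ! i) (as @ env)"
          if "as \<in> tuples (univ A) (ars \<tau>' ! i)" for as
          using Quant.IH[of i "as @ env"] i(2) that Quant.prems by (simp add: tuples_def)
        have "tuples (univ B) (ars \<tau>' ! i) = map h ` tuples (univ A) (ars \<tau>' ! i)"
        proof (intro equalityI subsetI)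
          fix bs assume bs: "bs \<in> tuples (univ B) (ars \<tau>' ! i)"
          then have "bs = map h (map (inv_into (univ A) h) bs)"
            unfolding im[symmetric] map_map
            by (intro map_idI[symmetric]) (auto simp: tuples_def f_inv_into_f subset_iff)
          moreover have "map (inv_into (univ A) h) bs \<in> tuples (univ A) (ars \<tau>' ! i)"
            using bs unfolding im[symmetric] by (auto simp: tuples_def inv_into_into subset_iff)
          ultimately show "bs \<in> map h ` tuples (univ A) (ars \<tau>' ! i)" by blast
        qed (auto simp: tuples_def im[symmetric] subset_iff)
        then show "rels (?S B (map h env)) ! i = map ((`) (map h)) (rels (?S A env)) ! i"
          using i sat by auto
      qed simp
    qed
    moreover have "wf_struct (?S A env)"
      using tm(2)[OF _ Quant.prems] ts
      by (auto simp: wf_struct_def tuples_def set_zip)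
    ultimately show ?case using has_property_iso by auto
  qed auto
qed

lemma sat_sentence_iso:
  assumes "A \<in> Str \<tau>" "is_fm L \<tau> 0 \<theta>" "isomorphic A B"
  shows "sat B \<theta> [] \<longleftrightarrow> sat A \<theta> []"
proof -
  obtain h where "bij_betw h (univ A) (univ B)" "rels B = map ((`) (map h)) (rels A)" "csts B = map h (csts A)"
    using assms(3) unfolding isomorphic_def by blast
  from sat_iso[OF this assms(1,2), of "[]"] show ?thesis by simp
qed

lemma is_property_models: "is_fm L \<tau> 0 \<theta> \<Longrightarrow> is_property \<tau> (models \<tau> \<theta>)"
  using sat_sentence_iso unfolding is_property_def models_def by blast

lemma nat_copy:
  assumes "A \<in> Str \<tau>"
  obtains B :: "nat struct" where "B \<in> Str \<tau>" "isomorphic A B"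
proof -
  obtain h :: "'a \<Rightarrow> nat" where h: "inj_on h (univ A)"
    using assms finite_imp_inj_to_nat_seg[of "univ A"] by (auto simp: Str_def)
  let ?B = "Struct (h ` univ A) (map ((`) (map h)) (rels A)) (map h (csts A))"
  have "rels A ! i \<subseteq> tuples (univ A) (ars \<tau> ! i)" if "i < length (ars \<tau>)" for i
    using assms that by (simp add: Str_def)
  then have "map h ` (rels A ! i) \<subseteq> tuples (h ` univ A) (ars \<tau> ! i)" if "i < length (ars \<tau>)" for i
    using that by (fastforce simp: tuples_def)
  then have "?B \<in> Str \<tau>" using assms by (auto simp: Str_def)
  moreover have "isomorphic A ?B"
    unfolding isomorphic_def using h by (intro exI[of _ h]) (auto simp: bij_betw_def)
  ultimately show ?thesis using that by blast
qed

text \<open>A structure over another type satisfies the same sentences as its copy on the natural numbers.\<close>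

lemma has_property_models:
  assumes "A \<in> Str \<tau>" "is_fm L \<tau> 0 \<theta>"
  shows "has_property A (models \<tau> \<theta>) \<longleftrightarrow> sat A \<theta> []"
proof
  assume "has_property A (models \<tau> \<theta>)"
  then show "sat A \<theta> []"
    using sat_sentence_iso[OF assms] unfolding has_property_def models_def by blast
next
  assume sat: "sat A \<theta> []"
  obtain B :: "nat struct" where "B \<in> Str \<tau>" "isomorphic A B" using nat_copy[OF assms(1)] .
  then show "has_property A (models \<tau> \<theta>)"
    using sat sat_sentence_iso[OF assms] unfolding has_property_def models_def by blast
qed

section \<open>Transductions form split families\<close>

text \<open>A term over a disjoint union takes its value on a side that depends only on the pattern and the term, and
  this value is computed from that side alone.\<close>

definition left_valued :: "voc \<Rightarrow> bool list \<Rightarrow> tm \<Rightarrow> (nat struct \<Rightarrow> nat list \<Rightarrow> nat) \<Rightarrow> bool" where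
  "left_valued \<sigma> s t \<alpha> \<longleftrightarrow> (\<forall>A\<in>Str \<sigma>. \<forall>B\<in>Str \<sigma>. \<forall>x y. length x = length s \<longrightarrow> length y = length s
     \<longrightarrow> tm_val (disj_union A (B :: nat struct)) (merge s x y) t = Inl (\<alpha> A x))"

definition right_valued :: "voc \<Rightarrow> bool list \<Rightarrow> tm \<Rightarrow> (nat struct \<Rightarrow> nat list \<Rightarrow> nat) \<Rightarrow> bool" where
  "right_valued \<sigma> s t \<beta> \<longleftrightarrow> (\<forall>A\<in>Str \<sigma>. \<forall>B\<in>Str \<sigma>. \<forall>x y. length x = length s \<longrightarrow> length y = length s
     \<longrightarrow> tm_val (disj_union (A :: nat struct) B) (merge s x y) t = Inr (\<beta> B y))"

lemma left_or_right_valued: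
  assumes "is_tm (disj_union_voc \<sigma>) (length s) t"
  shows "(\<exists>\<alpha>. left_valued \<sigma> s t \<alpha>) \<or> (\<exists>\<beta>. right_valued \<sigma> s t \<beta>)"
proof (cases t)
  case (Var v)
  show ?thesis
  proof (cases "s ! v")
    case True
    then have "left_valued \<sigma> s t (\<lambda>A x. x ! v)" using assms Var by (simp add: left_valued_def right_valued_def nth_merge)
    then show ?thesis by blast
  next
    case False
    then have "right_valued \<sigma> s t (\<lambda>B y. y ! v)" using assms Var by (simp add: left_valued_def right_valued_def nth_merge)
    then show ?thesis by blast
  qed
next
  case (Cst c)
  show ?thesis
  proof (cases "c < ncsts \<sigma>")
    case True
    then have "left_valued \<sigma> s t (\<lambda>A x. csts A ! c)" using Cst by (simp add: left_valued_def disj_union_def nth_append Str_def)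
    then show ?thesis by blast
  next
    case False
    then have "right_valued \<sigma> s t (\<lambda>B y. csts B ! (c - ncsts \<sigma>))"
      using Cst assms by (simp add: right_valued_def disj_union_def disj_union_voc_def nth_append Str_def)
    then show ?thesis by blast
  qed
qed

text \<open>An atomic formula over a disjoint union is false if its terms come from different sides, and otherwise
  depends on one side. Nullary relations fit in as a disjunction of both sides.\<close>

lemma qf_finitely_split:
  assumes "is_fm (\<lambda>_. {}) (disj_union_voc \<sigma>) n \<psi>" "quantifier_free \<psi>" and I: "I \<subseteq> Str \<sigma>" and J: "J \<subseteq> Str \<sigma>"
  shows "finitely_split I J univ univ n (\<lambda>A B. sat (disj_union A B) \<psi>)"
  unfolding finitely_split_def
proof (intro allI impI)
  fix s :: "bool list" assume s: "length s = n"
  show "few_rows (SIGMA A:I. tuples (univ A) n) (SIGMA B:J. tuples (univ B) n)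
    (\<lambda>p q. sat (disj_union (fst p) (fst q)) \<psi> (merge s (snd p) (snd q)))"
    using assms(1) s assms(2)
  proof (induction rule: is_fm.induct)
    case (Fls n)
    then show ?case by (simp add: few_rows_row)
  next
    case (Eq n t u)
    let ?I = "SIGMA A:I. tuples (univ A) n" and ?J = "SIGMA B:J. tuples (univ B) n"
    have IJ: "fst p \<in> Str \<sigma>" "length (snd p) = n" "fst q \<in> Str \<sigma>" "length (snd q) = n"
      if "p \<in> ?I" "q \<in> ?J" for p q
      using that I J by (auto simp: tuples_def)
    show ?case
      using left_or_right_valued[OF Eq(1)[folded Eq(3)]] left_or_right_valued[OF Eq(2)[folded Eq(3)]]
    proof (elim disjE exE)
      fix \<alpha> \<beta>
      assume "left_valued \<sigma> s t \<alpha>"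
        and "left_valued \<sigma> s u \<beta>"
      then show ?thesis
        by (intro few_rows_cong[OF few_rows_row[of _ _ "\<lambda>p. \<alpha> (fst p) (snd p) = \<beta> (fst p) (snd p)"]])
          (use IJ Eq(3) in \<open>simp add: left_valued_def right_valued_def\<close>)
    next
      fix \<alpha> \<beta>
      assume "left_valued \<sigma> s t \<alpha>"
        and "right_valued \<sigma> s u \<beta>"
      then show ?thesis
        by (intro few_rows_cong[OF few_rows_row[of _ _ "\<lambda>_. False"]]) (use IJ Eq(3) in \<open>simp add: left_valued_def right_valued_def\<close>)
    next
      fix \<alpha> \<beta>
      assume "right_valued \<sigma> s t \<alpha>"
        and "left_valued \<sigma> s u \<beta>"
      then show ?thesis
        by (intro few_rows_cong[OF few_rows_row[of _ _ "\<lambda>_. False"]]) (use IJ Eq(3) in \<open>simp add: left_valued_def right_valued_def\<close>)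
    next
      fix \<alpha> \<beta>
      assume "right_valued \<sigma> s t \<alpha>"
        and "right_valued \<sigma> s u \<beta>"
      then show ?thesis
        by (intro few_rows_cong[OF few_rows_col[of _ _ "\<lambda>q. \<alpha> (fst q) (snd q) = \<beta> (fst q) (snd q)"]])
          (use IJ Eq(3) in \<open>simp add: left_valued_def right_valued_def\<close>)
    qed
  next
    case (Rel i ts n)
    let ?I = "SIGMA A:I. tuples (univ A) n" and ?J = "SIGMA B:J. tuples (univ B) n"
    let ?val = "\<lambda>p q. map (tm_val (disj_union (fst p) (fst q)) (merge s (snd p) (snd q))) ts"
    let ?L = "left_valued \<sigma> s" and ?R = "right_valued \<sigma> s"
    have IJ: "fst p \<in> Str \<sigma>" "length (snd p) = n" "fst q \<in> Str \<sigma>" "length (snd q) = n"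
      if "p \<in> ?I" "q \<in> ?J" for p q
      using that I J by (auto simp: tuples_def)
    have LR: "(\<exists>\<alpha>. ?L t \<alpha>) \<or> (\<exists>\<beta>. ?R t \<beta>)" if "t \<in> set ts" for t
      using that Rel left_or_right_valued by auto
    have inj: "map Inl xs \<in> map Inl ` R \<longleftrightarrow> xs \<in> R" "map Inr ys \<in> map Inr ` R' \<longleftrightarrow> ys \<in> R'"
      for xs :: "nat list" and R and ys :: "nat list" and R'
      by (auto simp: image_iff map_injective inj_on_def)
    have "few_rows ?I ?J (\<lambda>p q. ?val p q \<in> map Inl ` (rels (fst p) ! i))"
    proof (cases "\<forall>t\<in>set ts. \<exists>\<alpha>. ?L t \<alpha>")
      case True
      then obtain \<alpha> where \<alpha>: "\<forall>t\<in>set ts. ?L t (\<alpha> t)" by metis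
      have "?val p q = map Inl (map (\<lambda>t. \<alpha> t (fst p) (snd p)) ts)" if "p \<in> ?I" "q \<in> ?J" for p q
        using \<alpha> IJ[OF that] Rel(4) by (simp add: left_valued_def)
      then show ?thesis
        by (intro few_rows_cong[OF few_rows_row[of _ _ "\<lambda>p. map (\<lambda>t. \<alpha> t (fst p) (snd p)) ts \<in> rels (fst p) ! i"]])
          (simp only: inj)
    next
      case False
      then obtain t \<beta> where t: "t \<in> set ts" "?R t \<beta>" using LR by blast
      have "?val p q \<notin> map Inl ` R" if "p \<in> ?I" "q \<in> ?J" for p q R
      proof
        assume "?val p q \<in> map Inl ` R"
        then have "set (?val p q) \<subseteq> range Inl" by (elim imageE) (simp only: set_map, blast)
        then have "tm_val (disj_union (fst p) (fst q)) (merge s (snd p) (snd q)) t \<in> range Inl"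
          using t(1) by auto
        then show False using t(2) IJ[OF that] Rel(4) by (auto simp: left_valued_def right_valued_def)
      qed
      then show ?thesis by (intro few_rows_cong[OF few_rows_row[of _ _ "\<lambda>_. False"]]) simp
    qed
    moreover have "few_rows ?I ?J (\<lambda>p q. ?val p q \<in> map Inr ` (rels (fst q) ! i))"
    proof (cases "\<forall>t\<in>set ts. \<exists>\<beta>. ?R t \<beta>")
      case True
      then obtain \<beta> where \<beta>: "\<forall>t\<in>set ts. ?R t (\<beta> t)" by metis
      have "?val p q = map Inr (map (\<lambda>t. \<beta> t (fst q) (snd q)) ts)" if "p \<in> ?I" "q \<in> ?J" for p q
        using \<beta> IJ[OF that] Rel(4) by (simp add: right_valued_def)
      then show ?thesis
        by (intro few_rows_cong[OF few_rows_col[of _ _ "\<lambda>q. map (\<lambda>t. \<beta> t (fst q) (snd q)) ts \<in> rels (fst q) ! i"]])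
          (simp only: inj)
    next
      case False
      then obtain t \<alpha> where t: "t \<in> set ts" "?L t \<alpha>" using LR by blast
      have "?val p q \<notin> map Inr ` R" if "p \<in> ?I" "q \<in> ?J" for p q R
      proof
        assume "?val p q \<in> map Inr ` R"
        then have "set (?val p q) \<subseteq> range Inr" by (elim imageE) (simp only: set_map, blast)
        then have "tm_val (disj_union (fst p) (fst q)) (merge s (snd p) (snd q)) t \<in> range Inr"
          using t(1) by auto
        then show False using t(2) IJ[OF that] Rel(4) by (auto simp: left_valued_def right_valued_def)
      qed
      then show ?thesis by (intro few_rows_cong[OF few_rows_row[of _ _ "\<lambda>_. False"]]) simp
    qed
    ultimately have "few_rows ?I ?J (\<lambda>p q. ?val p q \<in> map Inl ` (rels (fst p) ! i) \<or> ?val p q \<in> map Inr ` (rels (fst q) ! i))"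
      by (rule few_rows_disj)
    then show ?case
    proof (rule few_rows_cong)
      fix p q assume "p \<in> ?I" "q \<in> ?J"
      from IJ[OF this] have "length (rels (fst p)) = length (ars \<sigma>)" "length (rels (fst q)) = length (ars \<sigma>)"
        by (simp_all add: Str_def)
      then have "rels (disj_union (fst p) (fst q)) ! i = map Inl ` (rels (fst p) ! i) \<union> map Inr ` (rels (fst q) ! i)"
        using Rel.hyps(1) by (simp add: disj_union_def disj_union_voc_def)
      then show "sat (disj_union (fst p) (fst q)) (Rel i ts) (merge s (snd p) (snd q)) \<longleftrightarrow>
          ?val p q \<in> map Inl ` (rels (fst p) ! i) \<or> ?val p q \<in> map Inr ` (rels (fst q) ! i)"
        unfolding sat.simps by (simp only: Un_iff)
    qed
  next
    case (Neg n \<phi>)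
    then show ?case using few_rows_Not by simp
  next
    case (Conj n \<phi> \<psi>)
    then show ?case using few_rows_conj by simp
  qed auto
qed

text \<open>The base case from which all formulas are reached. Nonemptiness provides padding elements for the constants that
  come from the other side.\<close>

lemma split_family_transduction:
  assumes T: "induces \<sigma> \<tau> T (op_of \<tau> T)" and N: "N = {A \<in> Str \<sigma>. univ A \<noteq> {}}"
  shows "split_family (dim T) \<tau> N N univ univ (op_of \<tau> T)"
proof -
  define k where "k = dim T"
  have scheme: "is_scheme (disj_union_voc \<sigma>) \<tau> T"
    and op: "\<And>A B. A \<in> Str \<sigma> \<Longrightarrow> B \<in> Str \<sigma> \<Longrightarrow> op_of \<tau> T A B \<in> Str \<tau>"
    using T by (auto simp: induces_def)
  have NS: "N \<subseteq> Str \<sigma>" using N by auto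
  have U: "univ (op_of \<tau> T A B) = {w \<in> tuples (univ A <+> univ B) k. sat (disj_union A B) (dom_fm T) w}" for A B
    by (simp add: transduct_def Let_def k_def disj_union_def)
  have dom: "finitely_split N N univ univ k (\<lambda>A B. sat (disj_union A B) (dom_fm T))"
    using scheme by (intro qf_finitely_split[OF _ _ NS NS]) (auto simp: is_scheme_def is_qf_fm_def k_def)
  have merge: "merge s (snd p) (snd q) \<in> tuples (univ (fst p) <+> univ (fst q)) n"
    if "length s = n" "p \<in> (SIGMA A:N. tuples (univ A) n)" "q \<in> (SIGMA B:N. tuples (univ B) n)" for s p q n
    using that by (intro merge_in_tuples) auto
  show ?thesis
    unfolding split_family_def k_def[symmetric]
  proof (intro conjI)
    show "1 \<le> k" using scheme by (simp add: is_scheme_def k_def)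
    show "\<forall>A\<in>N. finite (univ A) \<and> univ A \<noteq> {}" "\<forall>A\<in>N. finite (univ A) \<and> univ A \<noteq> {}"
      using N by (auto simp: Str_def)
    have "op_of \<tau> T A B \<in> Str \<tau>" if "A \<in> N" "B \<in> N" for A B using op NS that by blast
    then show "\<forall>A\<in>N. \<forall>B\<in>N. univ (op_of \<tau> T A B) \<subseteq> tuples (univ A <+> univ B) k
          \<and> length (rels (op_of \<tau> T A B)) = length (ars \<tau>)
          \<and> (\<forall>q<length (ars \<tau>). rels (op_of \<tau> T A B) ! q \<subseteq> tuples (univ (op_of \<tau> T A B)) (ars \<tau> ! q))"
      by (auto simp: U Str_def)
    show "finitely_split N N univ univ k (\<lambda>A B w. w \<in> univ (op_of \<tau> T A B))"
      unfolding finitely_split_def U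
      by (intro allI impI few_rows_cong[OF finitely_splitD[OF dom]]) (use merge in auto)
    show "\<forall>q<length (ars \<tau>). finitely_split N N univ univ (k * ars \<tau> ! q)
          (\<lambda>A B w. chunks k (ars \<tau> ! q) w \<in> rels (op_of \<tau> T A B) ! q)"
      unfolding finitely_split_def
    proof (intro allI impI)
      fix q s assume q: "q < length (ars \<tau>)" and s: "length (s :: bool list) = k * ars \<tau> ! q"
      let ?r = "ars \<tau> ! q"
      let ?I = "SIGMA A:N. tuples (univ A) (k * ?r)"
      have "finitely_split N N univ univ (k * ?r) (\<lambda>A B. sat (disj_union A B) (rel_fms T ! q))"
        using scheme q by (intro qf_finitely_split[OF _ _ NS NS]) (auto simp: is_scheme_def is_qf_fm_def k_def)
      from few_rows_conj[OF finitely_splitD[OF this s]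
          few_rows_split_chunks[OF dom s, of ?I fst snd ?I fst snd]]
      have "few_rows ?I ?I (\<lambda>A B. sat (disj_union (fst A) (fst B)) (rel_fms T ! q) (merge s (snd A) (snd B)) \<and>
         (\<forall>v\<in>set (chunks k ?r (merge s (snd A) (snd B))). sat (disj_union (fst A) (fst B)) (dom_fm T) v))"
        by auto
      then show "few_rows ?I ?I (\<lambda>A B. chunks k ?r (merge s (snd A) (snd B)) \<in> rels (op_of \<tau> T (fst A) (fst B)) ! q)"
      proof (rule few_rows_cong)
        fix A B assume AB: "A \<in> ?I" "B \<in> ?I"
        let ?w = "merge s (snd A) (snd B)"
        have w: "?w \<in> tuples (univ (fst A) <+> univ (fst B)) (k * ?r)" using merge[OF s AB] .
        have R: "rels (op_of \<tau> T (fst A) (fst B)) ! q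
          = {xs \<in> tuples (univ (op_of \<tau> T (fst A) (fst B))) ?r. sat (disj_union (fst A) (fst B)) (rel_fms T ! q) (concat xs)}"
          using q scheme by (simp add: transduct_def Let_def is_scheme_def)
        have "concat (chunks k ?r ?w) = ?w" using w by (simp add: concat_chunks tuples_def)
        moreover have "chunks k ?r ?w \<in> tuples (univ (op_of \<tau> T (fst A) (fst B))) ?r
          \<longleftrightarrow> (\<forall>v\<in>set (chunks k ?r ?w). sat (disj_union (fst A) (fst B)) (dom_fm T) v)"
          using chunks_in_tuples[OF w] unfolding U tuples_def[of "{w \<in> _. _ w}"] by auto
        ultimately show "(chunks k ?r ?w \<in> rels (op_of \<tau> T (fst A) (fst B)) ! q) =
          (sat (disj_union (fst A) (fst B)) (rel_fms T ! q) ?w \<and>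
           (\<forall>v\<in>set (chunks k ?r ?w). sat (disj_union (fst A) (fst B)) (dom_fm T) v))"
          unfolding R by auto
      qed
    qed
    let ?cs = "cst_tuples T" and ?l = "ncsts \<sigma>"
    have cs: "length ?cs = ncsts \<tau>" "\<forall>\<kappa>\<in>set ?cs. length \<kappa> = k" "\<forall>c\<in>set (concat ?cs). c < 2 * ?l"
      using scheme by (auto simp: is_scheme_def k_def disj_union_voc_def)
    then have len: "length (concat ?cs) = k * ncsts \<tau>"
      using concat_in_tuples[of ?cs UNIV k] by (auto simp: tuples_def)
    let ?s = "map (\<lambda>c. c < ?l) (concat ?cs)"
    let ?f = "\<lambda>A. map (\<lambda>c. if c < ?l then csts A ! c else (SOME a. a \<in> univ A)) (concat ?cs)"
    let ?g = "\<lambda>B. map (\<lambda>c. if c < ?l then (SOME b. b \<in> univ B) else csts B ! (c - ?l)) (concat ?cs)"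
    have mem: "csts A ! c \<in> univ A" if "A \<in> N" "c < ?l" for A c
    proof -
      have "A \<in> Str \<sigma>" using that NS by blast
      then show ?thesis using that(2) nth_mem[of c "csts A"] by (auto simp: Str_def)
    qed
    have some: "(SOME a. a \<in> univ A) \<in> univ A" if "A \<in> N" for A
      using that N by (simp add: some_in_eq)
    show "\<exists>s f g. length s = k * ncsts \<tau>
          \<and> (\<forall>A\<in>N. f A \<in> tuples (univ A) (k * ncsts \<tau>)) \<and> (\<forall>B\<in>N. g B \<in> tuples (univ B) (k * ncsts \<tau>))
          \<and> (\<forall>A\<in>N. \<forall>B\<in>N. csts (op_of \<tau> T A B) = chunks k (ncsts \<tau>) (merge s (f A) (g B)))"
    proof (rule exI[of _ ?s], rule exI[of _ ?f], rule exI[of _ ?g], intro conjI ballI)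
      show "length ?s = k * ncsts \<tau>" using len by simp
      show "?f A \<in> tuples (univ A) (k * ncsts \<tau>)" if "A \<in> N" for A
        using len mem[OF that] some[OF that] by (auto simp: tuples_def)
      show "?g A \<in> tuples (univ A) (k * ncsts \<tau>)" if "A \<in> N" for A
      proof -
        have "c - ?l < ?l" if "c \<in> set (concat ?cs)" "\<not> c < ?l" for c using cs(3) that by fastforce
        then show ?thesis using len mem[OF that] some[OF that] by (auto simp: tuples_def)
      qed
      fix A B assume AB: "A \<in> N" "B \<in> N"
      then have "length (csts A) = ?l" "length (csts B) = ?l" using NS by (auto simp: Str_def)
      moreover have "concat ?cs ! v - ?l < ?l" if "v < length (concat ?cs)" "\<not> concat ?cs ! v < ?l" for v
        using bspec[OF cs(3) nth_mem[OF that(1)]] that(2) by linarith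
      ultimately have "merge ?s (?f A) (?g B) = map (\<lambda>c. csts (disj_union A B) ! c) (concat ?cs)"
        by (intro nth_equalityI) (auto simp: nth_merge disj_union_def nth_append)
      then have "chunks k (ncsts \<tau>) (merge ?s (?f A) (?g B))
          = map (map (\<lambda>c. csts (disj_union A B) ! c)) (chunks k (length ?cs) (concat ?cs))"
        using cs(1) by (simp add: map_chunks)
      also have "chunks k (length ?cs) (concat ?cs) = ?cs" using cs(2) by (rule chunks_concat)
      finally show "csts (op_of \<tau> T A B) = chunks k (ncsts \<tau>) (merge ?s (?f A) (?g B))"
        by (simp add: transduct_def Let_def)
    qed
  qed
qed

lemma finite_empty_structures: "finite {A :: 'a struct. A \<in> Str \<sigma> \<and> univ A = {}}" (is "finite ?E")
proof -
  have "?E \<subseteq> (\<lambda>rs. Struct {} rs []) `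
      {rs. set rs \<subseteq> Pow {[]} \<and> length rs = length (ars \<sigma>)}"
  proof
    fix A :: "'a struct" assume A: "A \<in> ?E"
    then have "set (rels A) \<subseteq> Pow {[]}"
      by (fastforce simp: Str_def tuples_def in_set_conv_nth)
    moreover have "A = Struct {} (rels A) []" using A by (cases A) (auto simp: Str_def)
    ultimately show "A \<in> (\<lambda>rs. Struct {} rs []) ` {rs. set rs \<subseteq> Pow {[]} \<and> length rs = length (ars \<sigma>)}"
      using A by (auto simp: Str_def)
  qed
  then show ?thesis using finite_lists_length_eq[of "Pow {[]}"] finite_subset by blast
qed

section \<open>The logics of properties of finite rank\<close>

lemma finite_rank_models:
  assumes L: "\<And>\<tau> \<Phi>. \<Phi> \<in> L \<tau> \<Longrightarrow> finite_rank K \<tau> \<Phi>" and \<theta>: "is_fm L \<tau> 0 \<theta>"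
  shows "finite_rank K \<tau> (models \<tau> \<theta>)"
  unfolding finite_rank_def
proof (intro allI impI)
  fix \<sigma> T assume k: "dim T \<in> K" and T: "induces \<sigma> \<tau> T (op_of \<tau> T)"
  define N where "N = {A \<in> Str \<sigma>. univ A \<noteq> ({} :: nat set)}"
  have op: "\<And>A B. A \<in> Str \<sigma> \<Longrightarrow> B \<in> Str \<sigma> \<Longrightarrow> op_of \<tau> T A B \<in> Str \<tau>"
    using T by (auto simp: induces_def)
  have "finitely_split N N univ univ (dim T * 0) (\<lambda>A B w.
     set (chunks (dim T) 0 w) \<subseteq> univ (op_of \<tau> T A B) \<and> sat (op_of \<tau> T A B) \<theta> (chunks (dim T) 0 w))"
  proof (rule split_family_formula[OF split_family_transduction[OF T N_def] k _ L \<theta>])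
    show "set (csts (op_of \<tau> T A B)) \<subseteq> univ (op_of \<tau> T A B)" if "A \<in> N" "B \<in> N" for A B
      using op[of A B] that by (simp add: N_def Str_def)
  qed
  from few_rows_split[OF this, of "[]" N "\<lambda>A. A" "\<lambda>_. []" N "\<lambda>A. A" "\<lambda>_. []"]
  have "few_rows N N (\<lambda>A B. sat (op_of \<tau> T A B) \<theta> [])"
    by (simp add: tuples_def)
  then have "few_rows (Str \<sigma>) (Str \<sigma>) (\<lambda>A B. sat (op_of \<tau> T A B) \<theta> [])"
    by (rule few_rows_cofinite)
      (auto simp: N_def intro: finite_subset[OF _ finite_empty_structures[of \<sigma>]])
  then show "few_rows (Str \<sigma>) (Str \<sigma>) (\<lambda>A B. has_property (op_of \<tau> T A B) (models \<tau> \<theta>))"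
    by (rule few_rows_cong) (rule has_property_models[OF op \<theta>])
qed

lemma property_is_models:
  assumes "is_property \<tau> \<Phi>" "\<Phi> \<in> L \<tau>"
  shows "\<exists>\<theta>. is_fm L \<tau> 0 \<theta> \<and> \<Phi> = models \<tau> \<theta>"
proof -
  let ?\<theta>s = "map (\<lambda>i. Rel i (map Var [0..<ars \<tau> ! i])) [0..<length (ars \<tau>)]"
  let ?\<theta> = "Quant \<tau> \<Phi> ?\<theta>s (map Cst [0..<ncsts \<tau>])"
  have "is_fm L \<tau> 0 ?\<theta>"
    using assms(2) by (auto intro!: is_fm.intros)
  moreover have "sat A ?\<theta> [] \<longleftrightarrow> A \<in> \<Phi>" if A: "A \<in> Str \<tau>" for A
  proof -
    let ?S = "Struct (univ A)
       (map2 (\<lambda>r P. {as \<in> tuples (univ A) r. P (as @ [])}) (ars \<tau>) (map (sat A) ?\<theta>s))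
       (map (tm_val A []) (map Cst [0..<ncsts \<tau>]))"
    have tm: "map (tm_val A as) (map Var [0..<r]) = as" if "as \<in> tuples (univ A) r" for as r
      using that by (intro nth_equalityI) (auto simp: tuples_def)
    have "csts ?S = csts A" using A by (auto simp: Str_def intro: nth_equalityI)
    moreover have "rels ?S = rels A"
    proof (rule nth_equalityI)
      show "length (rels ?S) = length (rels A)" using A by (simp add: Str_def)
      fix i assume "i < length (rels ?S)"
      then have i: "i < length (ars \<tau>)" by simp
      then have sub: "rels A ! i \<subseteq> tuples (univ A) (ars \<tau> ! i)" using A by (simp add: Str_def)
      have "rels ?S ! i = {as \<in> tuples (univ A) (ars \<tau> ! i). map (tm_val A as) (map Var [0..<ars \<tau> ! i]) \<in> rels A ! i}"
        using i by simp
      also have "\<dots> = {as \<in> tuples (univ A) (ars \<tau> ! i). as \<in> rels A ! i}"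
        by (rule Collect_cong) (simp only: tm cong: conj_cong)
      also have "\<dots> = rels A ! i" using sub by blast
      finally show "rels ?S ! i = rels A ! i" .
    qed
    ultimately have "?S = A" by (intro struct.expand) simp
    then show ?thesis using has_property_iff_mem[OF assms(1) A] by simp
  qed
  ultimately show ?thesis using assms(1) unfolding models_def is_property_def by blast
qed

lemma lindstrom_logic_finite_rank:
  assumes L: "\<And>\<tau>. L \<tau> = {\<Phi>. is_property \<tau> \<Phi> \<and> finite_rank K \<tau> \<Phi>}"
  shows "lindstrom_logic L"
  unfolding lindstrom_logic_def
proof (intro conjI allI ballI equalityI subsetI)
  show "is_property \<tau> \<Phi>" if "\<Phi> \<in> L \<tau>" for \<tau> \<Phi> using that L by blast
  show "\<Phi> \<in> {models \<tau> \<theta> |\<theta>. is_fm L \<tau> 0 \<theta>}" if "\<Phi> \<in> L \<tau>" for \<tau> \<Phi>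
    using property_is_models[of \<tau> \<Phi> L] that L by blast
  show "\<Phi> \<in> L \<tau>" if "\<Phi> \<in> {models \<tau> \<theta> |\<theta>. is_fm L \<tau> 0 \<theta>}" for \<tau> \<Phi>
    using that L is_property_models finite_rank_models[of L K] by blast
qed

theorem theorem8:
  shows "(lindstrom_logic S_properties \<and> logic_finite_S_rank S_properties)
       \<and> (lindstrom_logic P_properties \<and> logic_finite_P_rank P_properties)"
proof (intro conjI)
  show "lindstrom_logic S_properties"
    by (rule lindstrom_logic_finite_rank) (simp add: S_properties_def finite_S_rank_iff)
  show "lindstrom_logic P_properties"
    by (rule lindstrom_logic_finite_rank) (simp add: P_properties_def finite_P_rank_iff)
  show "logic_finite_S_rank S_properties" by (simp add: logic_finite_S_rank_def S_properties_def)
  show "logic_finite_P_rank P_properties" by (simp add: logic_finite_P_rank_def P_properties_def)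
qed

end
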